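(* Let $F:\mathbb{R}^n\to\mathbb{R}$ be a $\mathcal{C}^1$ function such that, for constants $0<\ell<L$, $\nu>0$ and exponents $1<p\le q<\infty$, one has for all $\xi,\eta\in\mathbb{R}^n$ $$\ell|\xi|^p\le F(\xi)\le L(1+|\xi|^q),$$ $$\nu\,|V_p(\xi)-V_p(\eta)|^2\le F(\xi)-F(\eta)-\langle F'(\eta),\xi-\eta\rangle,$$ and such that for every real $\lambda>1$ there is a constant $C(\lambda)$ with $F(\lambda\xi)\le C(\lambda)F(\xi)$ for every $\xi\in\mathbb{R}^n$. Assume moreover that $F(D\psi)\in L^1(\Omega)$ and $F(Du_0)\in L^1(\Omega)$. If $u\in\mathbb{K}_\psi^F(\Omega)$ is the solution to the obstacle problem $$\min\left\{\int_\Omega F(Dz)\,dx:\ z\in\mathbb{K}_\psi^F(\Omega)\right\},$$ then $$F^*(F'(Du))\in L^1(\Omega),\qquad \langle F'(Du),Du\rangle\in L^1(\Omega),$$ and $$\mathrm{div}\,F'(Du)\le 0$$ in the distributional sense in $\Omega$. Moreover the variational inequality $$\int_\Omega\langle F'(Du),Dz-Du\rangle\,dx\ge 0$$ holds for all $z\in\mathbb{K}_\psi^F(\Omega)$ such that $F(Dz)\in L^1(\Omega)$ and $F(-Dz)\in L^1(\Omega)$.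
   Context: Here $\Omega\subset\mathbb{R}^n$, $n\ge 2$, is a bounded open set; $\psi:\Omega\to[-\infty,+\infty)$ (the obstacle) is a weakly differentiable function with weak gradient $D\psi$; $u_0\in W^{1,p}(\Omega)$ is a fixed boundary value. The admissible class is $$\mathbb{K}_\psi^F(\Omega)=\{z\in u_0+W^{1,p}_0(\Omega):\ z\ge\psi\ \text{a.e. in }\Omega,\ F(Dz)\in L^1(\Omega)\},$$ and it is assumed to be nonempty. The auxiliary function is $V_p(\xi)=(1+|\xi|^2)^{\frac{p-2}{4}}\xi$ for $\xi\in\mathbb{R}^n$. $F'$ denotes the gradient of $F$, and $F^*$ is the polar (Fenchel conjugate) $F^*(\zeta)=\sup_{\xi\in\mathbb{R}^n}(\langle\zeta,\xi\rangle-F(\xi))$. The inequality $\mathrm{div}\,\sigma\le 0$ in the distributional sense means $\int_\Omega\langle\sigma,D\varphi\rangle\,dx\ge 0$ for all $\varphi\in\mathcal{C}_0^\infty(\Omega)$ with $\varphi\ge 0$. *)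

theory Defs
  imports "HOL-Analysis.Analysis"
begin

text \<open>Functions on \<open>\<Omega>\<close> are total functions whose values outside \<open>\<Omega>\<close> are irrelevant: they are
  only ever examined on \<open>\<Omega>\<close>, with respect to \<^term>\<open>lebesgue_on \<Omega>\<close> or on subsets of \<open>\<Omega>\<close>.\<close>

primrec Ck :: "nat \<Rightarrow> ('a::euclidean_space \<Rightarrow> real) \<Rightarrow> bool" where
  "Ck 0 f \<longleftrightarrow> continuous_on UNIV f"
| "Ck (Suc k) f \<longleftrightarrow> f differentiable_on UNIV \<and>
     (\<forall>b\<in>Basis. Ck k (\<lambda>x. frechet_derivative f (at x) b))"

text \<open>The test functions \<open>C\<^sub>0\<^sup>\<infinity>(\<Omega>)\<close>, extended by zero to the whole space.\<close>

definition test_functions :: "'a::euclidean_space set \<Rightarrow> ('a \<Rightarrow> real) set" where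
  "test_functions \<Omega> = {\<phi>. (\<forall>k. Ck k \<phi>) \<and>
     compact (closure {x. \<phi> x \<noteq> 0}) \<and> closure {x. \<phi> x \<noteq> 0} \<subseteq> \<Omega>}"

definition gradient :: "('a::euclidean_space \<Rightarrow> real) \<Rightarrow> 'a \<Rightarrow> 'a" where
  "gradient f x = (THE D. GDERIV f x :> D)"

definition locally_integrable ::
  "'a::euclidean_space set \<Rightarrow> ('a \<Rightarrow> 'b::euclidean_space) \<Rightarrow> bool" where
  "locally_integrable \<Omega> f \<longleftrightarrow>
     (\<forall>K. compact K \<and> K \<subseteq> \<Omega> \<longrightarrow> integrable (lebesgue_on K) f)"

definition has_weak_gradient ::
  "'a::euclidean_space set \<Rightarrow> ('a \<Rightarrow> real) \<Rightarrow> ('a \<Rightarrow> 'a) \<Rightarrow> bool" where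
  "has_weak_gradient \<Omega> u g \<longleftrightarrow> locally_integrable \<Omega> u \<and> locally_integrable \<Omega> g \<and>
     (\<forall>\<phi>\<in>test_functions \<Omega>.
        (LINT x|lebesgue_on \<Omega>. u x *\<^sub>R gradient \<phi> x) = - (LINT x|lebesgue_on \<Omega>. \<phi> x *\<^sub>R g x))"

definition weakly_differentiable ::
  "'a::euclidean_space set \<Rightarrow> ('a \<Rightarrow> real) \<Rightarrow> bool" where
  "weakly_differentiable \<Omega> u \<longleftrightarrow> (\<exists>g. has_weak_gradient \<Omega> u g)"

text \<open>On an open set the weak gradient is determined up to a null set; \<open>weak_grad\<close> selects one
  representative.\<close>

definition weak_grad :: "'a::euclidean_space set \<Rightarrow> ('a \<Rightarrow> real) \<Rightarrow> 'a \<Rightarrow> 'a" where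
  "weak_grad \<Omega> u = (SOME g. has_weak_gradient \<Omega> u g)"

definition Lp :: "'a::euclidean_space set \<Rightarrow> real \<Rightarrow> ('a \<Rightarrow> 'b::euclidean_space) set" where
  "Lp \<Omega> p = {f. f \<in> borel_measurable (lebesgue_on \<Omega>) \<and>
     integrable (lebesgue_on \<Omega>) (\<lambda>x. norm (f x) powr p)}"

definition W1p :: "'a::euclidean_space set \<Rightarrow> real \<Rightarrow> ('a \<Rightarrow> real) set" where
  "W1p \<Omega> p = {u. u \<in> Lp \<Omega> p \<and> weakly_differentiable \<Omega> u \<and> weak_grad \<Omega> u \<in> Lp \<Omega> p}"

definition W1p_norm :: "'a::euclidean_space set \<Rightarrow> real \<Rightarrow> ('a \<Rightarrow> real) \<Rightarrow> real" where
  "W1p_norm \<Omega> p u = ((LINT x|lebesgue_on \<Omega>. norm (u x) powr p) +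
     (LINT x|lebesgue_on \<Omega>. norm (weak_grad \<Omega> u x) powr p)) powr (1 / p)"

definition W1p_0 :: "'a::euclidean_space set \<Rightarrow> real \<Rightarrow> ('a \<Rightarrow> real) set" where
  "W1p_0 \<Omega> p = {u \<in> W1p \<Omega> p.
     \<forall>\<epsilon>>0. \<exists>\<phi>\<in>test_functions \<Omega>. W1p_norm \<Omega> p (\<lambda>x. u x - \<phi> x) < \<epsilon>}"

text \<open>As \<^term>\<open>real_of_ereal\<close> maps infinite values to zero, finiteness almost everywhere is
  required explicitly. Measurability of \<open>f\<close> is implied, the measure being complete.\<close>

definition ereal_integrable_on :: "'a::euclidean_space set \<Rightarrow> ('a \<Rightarrow> ereal) \<Rightarrow> bool" where
  "ereal_integrable_on \<Omega> f \<longleftrightarrow> (AE x in lebesgue_on \<Omega>. \<bar>f x\<bar> \<noteq> \<infinity>) \<and>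
     integrable (lebesgue_on \<Omega>) (\<lambda>x. real_of_ereal (f x))"

definition ereal_weakly_differentiable ::
  "'a::euclidean_space set \<Rightarrow> ('a \<Rightarrow> ereal) \<Rightarrow> bool" where
  "ereal_weakly_differentiable \<Omega> f \<longleftrightarrow> (AE x in lebesgue_on \<Omega>. \<bar>f x\<bar> \<noteq> \<infinity>) \<and>
     weakly_differentiable \<Omega> (\<lambda>x. real_of_ereal (f x))"

definition ereal_weak_grad :: "'a::euclidean_space set \<Rightarrow> ('a \<Rightarrow> ereal) \<Rightarrow> 'a \<Rightarrow> 'a" where
  "ereal_weak_grad \<Omega> f = weak_grad \<Omega> (\<lambda>x. real_of_ereal (f x))"

definition V :: "real \<Rightarrow> 'a::euclidean_space \<Rightarrow> 'a" where
  "V p \<xi> = (1 + (norm \<xi>)\<^sup>2) powr ((p - 2) / 4) *\<^sub>R \<xi>"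

definition polar :: "('a::euclidean_space \<Rightarrow> real) \<Rightarrow> 'a \<Rightarrow> ereal" where
  "polar F \<zeta> = (SUP \<xi>. ereal (\<zeta> \<bullet> \<xi> - F \<xi>))"

definition admissible ::
  "'a::euclidean_space set \<Rightarrow> real \<Rightarrow> ('a \<Rightarrow> real) \<Rightarrow> ('a \<Rightarrow> ereal) \<Rightarrow> ('a \<Rightarrow> real) \<Rightarrow> ('a \<Rightarrow> real) set"
where
  "admissible \<Omega> p F \<psi> u\<^sub>0 = {z. (\<lambda>x. z x - u\<^sub>0 x) \<in> W1p_0 \<Omega> p \<and>
     (AE x in lebesgue_on \<Omega>. \<psi> x \<le> ereal (z x)) \<and>
     integrable (lebesgue_on \<Omega>) (\<lambda>x. F (weak_grad \<Omega> z x))}"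

text \<open>\<open>div \<sigma> \<le> 0\<close> in the sense of distributions. Since the Bochner integral of a non-integrable
  function is zero, existence of the integrals is part of the definition.\<close>

definition distributional_div_nonpos ::
  "'a::euclidean_space set \<Rightarrow> ('a \<Rightarrow> 'a) \<Rightarrow> bool" where
  "distributional_div_nonpos \<Omega> \<sigma> \<longleftrightarrow> (\<forall>\<phi>\<in>test_functions \<Omega>. (\<forall>x. 0 \<le> \<phi> x) \<longrightarrow>
     integrable (lebesgue_on \<Omega>) (\<lambda>x. \<sigma> x \<bullet> gradient \<phi> x) \<and>
     0 \<le> (LINT x|lebesgue_on \<Omega>. \<sigma> x \<bullet> gradient \<phi> x))"

end

theory Submission
  imports Defs
begin

text \<open>By doubling, \<open>F'(\<xi>) \<bullet> \<xi> \<le> F(2\<xi>) - F(\<xi>)\<close> is controlled by \<open>F(\<xi>)\<close>, and the conjugate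
  satisfies \<open>F\<^sup>*(F'(\<xi>)) = F'(\<xi>) \<bullet> \<xi> - F(\<xi>)\<close>, so both integrability claims hold pointwise. The
  supporting hyperplane inequality at \<open>Du\<close>, tested with \<open>\<plusminus>\<xi>\<close>, bounds \<open>F'(Du) \<bullet> \<xi>\<close> by
  \<open>F(\<xi>) + F(-\<xi>) + \<bar>F'(Du) \<bullet> Du\<bar>\<close>. For an admissible competitor \<open>z\<close> the difference quotients of
  \<open>F\<close> along the segment from \<open>Du\<close> to \<open>Dz\<close> lie between \<open>F'(Du) \<bullet> (Dz - Du)\<close> and
  \<open>F(Dz) - F(Du)\<close>, so dominated convergence turns minimality into the variational inequality. The
  divergence inequality is the case \<open>z = u + \<phi>\<close>, admissible because convexity and doubling give
  \<open>2 F(Du + D\<phi>) \<le> C F(Du) + F(2 D\<phi>)\<close>.\<close>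

section \<open>Smooth functions\<close>

text \<open>The convex analysis is short; most of the work answers to \<open>weak_grad\<close> being
  an arbitrary choice of representative. Formulas for the weak gradient of a sum or a convex
  combination hold only almost everywhere and rest on uniqueness of weak gradients. Uniqueness is
  the fundamental lemma, which needs smooth functions supported in prescribed boxes. Conversely, the
  competitor u + phi requires that a test function has its classical gradient as weak gradient,
  which is integration by parts. The analytic obstacle is integrability: Du is only known to be
  p-integrable while F may grow like the power q, so Hoelder's inequality does not control F'(Du)
  against Dz. All bounds must therefore be expressed through F itself. The inequality for V_p enters
  through the sign of its left side, which provides a supporting hyperplane at every point.\<close>

lemma Ck_Suc_imp_Ck: "Ck (Suc k) f \<Longrightarrow> Ck k f"
proof (induction k arbitrary: f)
  case 0
  then show ?case by (simp add: differentiable_imp_continuous_on)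
next
  case (Suc k)
  then show ?case by (metis Ck.simps(2))
qed

lemma Ck_const: "Ck k (\<lambda>_. c)"
proof (induction k arbitrary: c)
  case (Suc k)
  have "frechet_derivative (\<lambda>_. c) (at x) = (\<lambda>_. 0)" for x :: 'a
    by (rule frechet_derivative_at[symmetric]) (rule has_derivative_const)
  then show ?case using Suc by simp
qed simp

lemma Ck_add: "Ck k f \<Longrightarrow> Ck k g \<Longrightarrow> Ck k (\<lambda>x. f x + g x)"
proof (induction k arbitrary: f g)
  case 0
  then show ?case by (simp add: continuous_on_add)
next
  case (Suc k)
  then have diff: "f differentiable at x" "g differentiable at x" for x
    by (auto simp: differentiable_on_def)
  have "frechet_derivative (\<lambda>x. f x + g x) (at x)
      = (\<lambda>h. frechet_derivative f (at x) h + frechet_derivative g (at x) h)" for x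
    by (rule frechet_derivative_at[symmetric])
       (intro has_derivative_add frechet_derivative_works[THEN iffD1] diff)
  then show ?case using Suc by (simp add: differentiable_on_add)
qed

text \<open>The product rule leaves undifferentiated factors, so the induction step also consumes
  \<open>Ck k\<close> of the factors themselves, which \<open>Ck_Suc_imp_Ck\<close>
  supplies.\<close>

lemma Ck_mult: "Ck k f \<Longrightarrow> Ck k g \<Longrightarrow> Ck k (\<lambda>x. f x * g x)"
proof (induction k arbitrary: f g)
  case 0
  then show ?case by (simp add: continuous_on_mult)
next
  case (Suc k)
  then have diff: "f differentiable at x" "g differentiable at x" for x
    by (auto simp: differentiable_on_def)
  have "frechet_derivative (\<lambda>x. f x * g x) (at x)
      = (\<lambda>h. f x * frechet_derivative g (at x) h + frechet_derivative f (at x) h * g x)" for x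
    by (rule frechet_derivative_at[symmetric])
       (intro has_derivative_mult frechet_derivative_works[THEN iffD1] diff)
  moreover have "(\<lambda>x. f x * g x) differentiable_on UNIV"
    using diff by (simp add: differentiable_on_def)
  ultimately show ?case
    using Suc.prems Suc.prems[THEN Ck_Suc_imp_Ck] by (simp add: Ck_add Suc.IH)
qed

lemma Ck_prod: "(\<And>i. i \<in> I \<Longrightarrow> Ck k (f i)) \<Longrightarrow> Ck k (\<lambda>x. \<Prod>i\<in>I. f i x)"
  by (induction I rule: infinite_finite_induct) (auto simp: Ck_const Ck_mult)

text \<open>Closed under differentiation; \<open>flat 1\<close> is the standard smooth function vanishing exactly on
  the nonpositive half-line.\<close>

definition flat :: "real poly \<Rightarrow> real \<Rightarrow> real" where
  "flat P s = (if 0 < s then poly P (1 / s) * exp (- (1 / s)) else 0)"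

lemma poly_mult_exp_tendsto_0: "((\<lambda>y::real. poly P y * exp (- y)) \<longlongrightarrow> 0) at_top"
proof -
  have "((\<lambda>y. coeff P i * (y ^ i * exp (- y))) \<longlongrightarrow> coeff P i * 0) at_top" for i
    by (intro tendsto_mult_left) (use tendsto_power_div_exp_0[of i] in \<open>simp add: exp_minus field_simps\<close>)
  then have "((\<lambda>y. \<Sum>i\<le>degree P. coeff P i * (y ^ i * exp (- y))) \<longlongrightarrow> (\<Sum>i\<le>degree P. 0)) at_top"
    by (intro tendsto_sum) auto
  then show ?thesis by (simp add: poly_altdef sum_distrib_right mult.assoc)
qed

text \<open>With y = 1/s, the derivative of P(y) exp(-y) in s is y^2 (P(y) - P'(y)) exp(-y), because
  dy/ds = -y^2; \<open>[:0, 0, 1:]\<close> is the polynomial y^2. Only s = 0 needs a limit, and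
  there exp(-y) beats every polynomial.\<close>

lemma flat_has_real_derivative:
  "(flat P has_real_derivative flat ([:0, 0, 1:] * (P - pderiv P)) s) (at s)"
proof -
  consider "s < 0" | "s = 0" | "0 < s" by linarith
  then show ?thesis
  proof cases
    case 1
    have "(flat P has_real_derivative 0) (at s)"
      by (rule DERIV_cong_ev[THEN iffD2, OF refl _ refl DERIV_const])
         (use 1 in \<open>auto simp: flat_def eventually_nhds intro!: exI[of _ "{..<0}"]\<close>)
    then show ?thesis using 1 by (simp add: flat_def)
  next
    case 2
    have "((\<lambda>h. flat P h / h) \<longlongrightarrow> 0) (at_right 0)"
    proof -
      \<comment> \<open>\<open>pCons 0 P\<close> is y P(y): the extra factor y = 1/h is the
        denominator of the difference quotient.\<close>
      have "((\<lambda>h::real. poly (pCons 0 P) (1/h) * exp (- (1/h))) \<longlongrightarrow> 0) (at_right 0)"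
        by (rule filterlim_compose[OF poly_mult_exp_tendsto_0])
           (simp add: filterlim_inverse_at_top_right flip: inverse_eq_divide)
      then show ?thesis
        by (rule Lim_transform_eventually)
           (auto simp: eventually_at flat_def intro!: exI[of _ 1])
    qed
    moreover have "((\<lambda>h. flat P h / h) \<longlongrightarrow> 0) (at_left 0)"
      by (rule Lim_transform_eventually[OF tendsto_const])
         (auto simp: eventually_at flat_def intro!: exI[of _ 1])
    ultimately have "((\<lambda>h. flat P h / h) \<longlongrightarrow> 0) (at 0)"
      by (simp add: filterlim_split_at)
    then show ?thesis using 2 by (simp add: DERIV_def flat_def)
  next
    case 3
    have "((\<lambda>s. poly P (1 / s) * exp (- (1 / s))) has_real_derivative
            flat ([:0, 0, 1:] * (P - pderiv P)) s) (at s)"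
      using 3 
      by (auto intro!: derivative_eq_intros poly_DERIV[THEN DERIV_chain2] simp: flat_def field_simps power2_eq_square)
    then show ?thesis
      by (rule DERIV_cong_ev[THEN iffD1, rotated -1])
         (use 3 in \<open>auto simp: flat_def eventually_nhds intro!: exI[of _ "{0<..}"]\<close>)
  qed
qed

text \<open>The induction runs over all polynomials at once, since each differentiation replaces P
  by another polynomial and pulls out the constant c \<bullet> h.\<close>

lemma Ck_flat: "Ck k (\<lambda>x. flat P (c \<bullet> x - d))"
proof (induction k arbitrary: P)
  case 0
  have "isCont (flat P) s" for s
    using flat_has_real_derivative by (rule DERIV_isCont)
  then have "continuous_on UNIV (flat P)"
    by (simp add: continuous_at_imp_continuous_on)
  then show ?case
    by (auto intro!: continuous_on_compose2[of UNIV "flat P"] continuous_intros)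
next
  case (Suc k)
  have deriv: "((\<lambda>x. flat P (c \<bullet> x - d)) has_derivative
      (\<lambda>h. (c \<bullet> h) * flat ([:0, 0, 1:] * (P - pderiv P)) (c \<bullet> x - d))) (at x)" for x
  proof -
    have "((\<lambda>x. c \<bullet> x - d) has_derivative (\<lambda>h. c \<bullet> h)) (at x)"
      by (auto intro!: derivative_eq_intros)
    moreover have "(flat P has_derivative (\<lambda>h. flat ([:0, 0, 1:] * (P - pderiv P)) (c \<bullet> x - d) * h))
        (at (c \<bullet> x - d))"
      using flat_has_real_derivative[of P] unfolding has_field_derivative_def .
    ultimately show ?thesis
      using has_derivative_compose by (force simp: mult.commute)
  qed
  have "frechet_derivative (\<lambda>x. flat P (c \<bullet> x - d)) (at x)
      = (\<lambda>h. (c \<bullet> h) * flat ([:0, 0, 1:] * (P - pderiv P)) (c \<bullet> x - d))" for x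
    by (rule frechet_derivative_at[symmetric]) (rule deriv)
  moreover have "(\<lambda>x. flat P (c \<bullet> x - d)) differentiable_on UNIV"
    using deriv by (auto simp: differentiable_on_def differentiable_def)
  ultimately show ?case
    using Ck_mult[OF Ck_const Suc] by simp
qed

section \<open>The fundamental lemma of the calculus of variations\<close>

text \<open>The factor exp(-1/(m s)) tends to 1 for fixed s > 0 as m grows, while
  \<open>flat 1\<close> stays 0 for s \<le> 0. A product of such factors over the faces of the box
  thus converges to its indicator from below, with no cut-off or mollification.\<close>

lemma box_indicator_approx:
  fixes a b :: "'a::euclidean_space"
  obtains \<phi> :: "nat \<Rightarrow> 'a \<Rightarrow> real" where
    "\<And>n k. Ck k (\<phi> n)" "\<And>n x. 0 \<le> \<phi> n x" "\<And>n x. \<phi> n x \<le> 1"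
    "\<And>n x. x \<notin> box a b \<Longrightarrow> \<phi> n x = 0"
    "\<And>x. (\<lambda>n. \<phi> n x) \<longlonglongrightarrow> indicator (box a b) x"
proof -
  \<comment> \<open>In coordinates the factors are \<open>flat 1\<close> at m (x_i - a_i) and at m
    (b_i - x_i), with m = \<open>Suc n\<close> positive also for n = 0. They are written in the form
    c \<bullet> x - d so that \<open>Ck_flat\<close> applies.\<close>
  define \<phi> :: "nat \<Rightarrow> 'a \<Rightarrow> real" where
    "\<phi> n x = (\<Prod>i\<in>Basis. flat 1 ((real (Suc n) *\<^sub>R i) \<bullet> x - real (Suc n) * (a \<bullet> i)) *
                          flat 1 ((- real (Suc n) *\<^sub>R i) \<bullet> x - (- (real (Suc n) * (b \<bullet> i)))))" for n x
  have bounds: "0 \<le> flat 1 s" "flat 1 s \<le> 1" for s :: real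
    by (auto simp: flat_def)
  have outside: "\<phi> n x = 0" if "x \<notin> box a b" for n x
  proof -
    obtain i where i: "i \<in> Basis" "x \<bullet> i \<le> a \<bullet> i \<or> b \<bullet> i \<le> x \<bullet> i"
      using \<open>x \<notin> box a b\<close> by (force simp: mem_box)
    have "real (Suc n) * (x \<bullet> i) \<le> real (Suc n) * (a \<bullet> i) \<or>
          real (Suc n) * (b \<bullet> i) \<le> real (Suc n) * (x \<bullet> i)"
      using i(2) by (auto intro: mult_left_mono)
    then have "flat 1 ((real (Suc n) *\<^sub>R i) \<bullet> x - real (Suc n) * (a \<bullet> i)) *
      flat 1 ((- real (Suc n) *\<^sub>R i) \<bullet> x - (- (real (Suc n) * (b \<bullet> i)))) = 0"
      by (auto simp: flat_def inner_commute simp del: of_nat_Suc)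
    with i(1) show ?thesis unfolding \<phi>_def by (meson finite_Basis prod_zero)
  qed
  have factor: "(\<lambda>n. flat 1 (real (Suc n) * s)) \<longlonglongrightarrow> 1" if "0 < s" for s :: real
  proof -
    have "filterlim (\<lambda>n. real (Suc n) * s) at_top sequentially"
      by (intro filterlim_at_top_mult_tendsto_pos[OF tendsto_const \<open>0 < s\<close>]
          filterlim_compose[OF filterlim_real_sequentially] filterlim_Suc)
    then have "(\<lambda>n. 1 / (real (Suc n) * s)) \<longlonglongrightarrow> 0"
      by (intro tendsto_divide_0[OF tendsto_const] filterlim_at_top_imp_at_infinity)
    then have "(\<lambda>n. exp (- (1 / (real (Suc n) * s)))) \<longlonglongrightarrow> exp (- 0)"
      by (intro tendsto_intros)
    with \<open>0 < s\<close> show ?thesis by (simp add: flat_def)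
  qed
  show thesis
  proof (rule that[of \<phi>])
    show "Ck k (\<phi> n)" for n k
      unfolding \<phi>_def by (intro Ck_prod Ck_mult Ck_flat)
    show "0 \<le> \<phi> n x" "\<phi> n x \<le> 1" for n x
      unfolding \<phi>_def by (auto intro!: prod_nonneg prod_le_1 mult_nonneg_nonneg mult_le_one bounds)
    show "\<phi> n x = 0" if "x \<notin> box a b" for n x
      by (rule outside) fact
    show "(\<lambda>n. \<phi> n x) \<longlonglongrightarrow> indicator (box a b) x" for x
    proof (cases "x \<in> box a b")
      case True
      have eq: "\<phi> n x = (\<Prod>i\<in>Basis. flat 1 (real (Suc n) * (x \<bullet> i - a \<bullet> i)) *
                          flat 1 (real (Suc n) * (b \<bullet> i - x \<bullet> i)))" for n
        unfolding \<phi>_def by (intro prod.cong refl) (simp add: algebra_simps inner_commute)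
      have "(\<lambda>n. \<phi> n x) \<longlonglongrightarrow> (\<Prod>i\<in>(Basis::'a set). 1 * 1)"
        unfolding eq using True by (intro tendsto_prod tendsto_mult factor) (auto simp: mem_box)
      then show ?thesis using True by simp
    qed (simp add: outside)
  qed
qed

section \<open>Functions whose integral vanishes on every box\<close>

lemma integrable_set_lebesgue_eq:
  fixes f :: "'a::euclidean_space \<Rightarrow> 'b::euclidean_space"
  assumes "S \<in> sets lebesgue"
  shows "integrable (lebesgue_on S) f \<longleftrightarrow> set_integrable lebesgue S f"
    and "integral\<^sup>L (lebesgue_on S) f = set_lebesgue_integral lebesgue S f"
  using assms by (simp_all add: set_integrable_def set_lebesgue_integral_def
      integrable_restrict_space integral_restrict_space)

lemma sigma_finite_lebesgue: "sigma_finite_measure (lebesgue :: 'a::euclidean_space measure)"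
proof
  obtain A :: "'a set set" where "countable A" "A \<subseteq> sets lborel" "\<Union>A = space lborel"
    "\<forall>a\<in>A. emeasure lborel a \<noteq> \<infinity>"
    using lborel.sigma_finite_countable by blast
  then show "\<exists>A::'a set set. countable A \<and> A \<subseteq> sets lebesgue \<and> \<Union>A = space lebesgue \<and>
      (\<forall>a\<in>A. emeasure lebesgue a \<noteq> \<infinity>)"
    by (intro exI[of _ A]) auto
qed

text \<open>A Dynkin argument: boxes are closed under intersection and generate the Borel sets, and
  the sets on which h integrates to 0 are closed under complements and disjoint countable unions.
  The total integral is a separate hypothesis because the whole space is not a box, and the
  complement step needs it.\<close>

lemma AE_zero_if_zero_on_boxes:
  fixes h :: "'a::euclidean_space \<Rightarrow> 'b::euclidean_space"
  assumes h: "integrable lebesgue h" and total: "(LINT x|lebesgue. h x) = 0"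
    and boxes: "\<And>a b. (LINT x:box a b|lebesgue. h x) = 0"
  shows "AE x in lebesgue. h x = 0"
proof -
  have set_h: "set_integrable lebesgue A h" if "A \<in> sets lebesgue" for A
    unfolding set_integrable_def using that h by (rule integrable_mult_indicator)
  have borel: "(LINT x:A|lebesgue. h x) = 0" if "A \<in> sets borel" for A
  proof -
    let ?G = "range (\<lambda>(a, b). box a b) :: 'a set set"
    have gen: "sets (borel :: 'a measure) = sigma_sets UNIV ?G"
      by (subst borel_eq_box) simp
    have sub: "sigma_sets UNIV ?G \<subseteq> sets lebesgue"
      unfolding gen[symmetric] by auto
    have "Int_stable ?G" by (auto simp: Int_stable_def box_Int_box)
    moreover have "?G \<subseteq> Pow UNIV" by simp
    moreover have "A \<in> sigma_sets UNIV ?G" using that unfolding gen .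
    ultimately show ?thesis
    proof (induction rule: sigma_sets_induct_disjoint)
      case (basic A)
      then show ?case using boxes by auto
    next
      case empty
      then show ?case by (simp add: set_lebesgue_integral_def)
    next
      case (compl A)
      then have A: "A \<in> sets lebesgue" using sub by blast
      have "(LINT x:A \<union> (UNIV - A)|lebesgue. h x)
          = (LINT x:A|lebesgue. h x) + (LINT x:UNIV - A|lebesgue. h x)"
        using A by (intro set_integral_Un set_h) auto
      then show ?case using compl total by (simp add: set_lebesgue_integral_def)
    next
      case (union A)
      then have A: "A i \<in> sets lebesgue" for i using sub by blast
      have "(LINT x:(\<Union>i. A i)|lebesgue. h x) = (\<Sum>i. (LINT x:(A i)|lebesgue. h x))"
        using A union by (intro lebesgue_integral_countable_add set_h)
          (auto simp: disjoint_family_on_def)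
      then show ?case using union by simp
    qed
  qed
  have "(LINT x:A|lebesgue. h x) = 0" if "A \<in> sets lebesgue" for A
  proof -
    \<comment> \<open>A Lebesgue set is a Borel set up to a subset of a Borel null set, so the Borel
      case carries over.\<close>
    obtain S N N' where A: "A = S \<union> N" "N \<subseteq> N'" "N' \<in> null_sets lborel" "S \<in> sets lborel"
      using \<open>A \<in> sets lebesgue\<close> by (rule sets_completionE)
    have "AE x in lebesgue. x \<notin> N'"
      using A(3) by (intro AE_completion AE_not_in) simp
    then have "AE x in lebesgue. indicat_real A x *\<^sub>R h x = indicat_real S x *\<^sub>R h x"
      by eventually_elim (use A in \<open>auto simp: indicator_def\<close>)
    then have "(LINT x:A|lebesgue. h x) = (LINT x:S|lebesgue. h x)"
      unfolding set_lebesgue_integral_def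
      using h \<open>A \<in> sets lebesgue\<close> A(4)
      by (intro integral_cong_AE borel_measurable_scaleR borel_measurable_indicator
          borel_measurable_integrable[OF h]) (auto intro: sets_completionI_sets)
    then show ?thesis using borel A by simp
  qed
  then show ?thesis
    using sigma_finite_measure.density_zero[OF sigma_finite_lebesgue h] by blast
qed

text \<open>An open set is a countable union of closed boxes, whose boundaries are null. Hence P is
  wanted only on the interior of each box, while the closed box inside \<Omega> provides the
  compactness for local integrability.\<close>

lemma open_AE_lebesgue_on:
  fixes \<Omega> :: "'a::euclidean_space set"
  assumes "open \<Omega>" and AE: "\<And>a b. cbox a b \<subseteq> \<Omega> \<Longrightarrow> AE x in lebesgue. x \<in> box a b \<longrightarrow> P x"
  shows "AE x in lebesgue_on \<Omega>. P x"
proof -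
  obtain \<D> where \<D>: "countable \<D>" "\<D> \<subseteq> Pow \<Omega>" "\<And>X. X \<in> \<D> \<Longrightarrow> \<exists>a b. X = cbox a b" "\<Union>\<D> = \<Omega>"
    using open_countable_Union_open_cbox[OF \<open>open \<Omega>\<close>] by metis
  have "AE x in lebesgue. x \<in> X \<longrightarrow> P x" if "X \<in> \<D>" for X
  proof -
    obtain a b where X: "X = cbox a b" using \<D>(3) \<open>X \<in> \<D>\<close> by meson
    have "AE x in lebesgue. x \<notin> cbox a b - box a b"
      using negligible_frontier_interval[of a b] by (intro AE_not_in) (simp add: negligible_iff_null_sets)
    moreover have "AE x in lebesgue. x \<in> box a b \<longrightarrow> P x"
      using AE X that \<D>(2) by blast
    ultimately show ?thesis by eventually_elim (auto simp: X)
  qed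
  then have "AE x in lebesgue. \<forall>X\<in>\<D>. x \<in> X \<longrightarrow> P x"
    unfolding AE_ball_countable[OF \<D>(1)] by blast
  then have "AE x in lebesgue. x \<in> \<Omega> \<longrightarrow> P x"
    by eventually_elim (use \<D>(4) in blast)
  then show ?thesis
    using \<open>open \<Omega>\<close> by (subst AE_restrict_space_iff) auto
qed

lemma test_functionsI:
  assumes "\<And>k. Ck k \<phi>" "compact K" "K \<subseteq> \<Omega>" "\<And>x. x \<notin> K \<Longrightarrow> \<phi> x = 0"
  shows "\<phi> \<in> test_functions \<Omega>"
proof -
  have "{x. \<phi> x \<noteq> 0} \<subseteq> K" using assms(4) by blast
  then have "closure {x. \<phi> x \<noteq> 0} \<subseteq> K"
    using \<open>compact K\<close> by (simp add: closure_minimal compact_imp_closed)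
  then show ?thesis
    using assms unfolding test_functions_def
    by (auto simp: compact_eq_bounded_closed intro: bounded_subset)
qed

text \<open>On a closed box inside \<Omega>, g is integrable. Testing with smooth functions that
  increase no further than the indicator of a smaller open box, and passing to the limit under the
  bound |g|, shows that g integrates to 0 over every such box.\<close>

lemma fundamental_lemma:
  fixes g :: "'a::euclidean_space \<Rightarrow> 'b::euclidean_space"
  assumes "open \<Omega>" and g: "locally_integrable \<Omega> g"
    and zero: "\<And>\<phi>. \<phi> \<in> test_functions \<Omega> \<Longrightarrow> (LINT x|lebesgue_on \<Omega>. \<phi> x *\<^sub>R g x) = 0"
  shows "AE x in lebesgue_on \<Omega>. g x = 0"
proof (rule open_AE_lebesgue_on[OF \<open>open \<Omega>\<close>])
  fix c d :: 'a
  assume sub: "cbox c d \<subseteq> \<Omega>"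
  \<comment> \<open>Cutting g off to an open box makes h integrable on the whole space; its integral
    over any box is that of g over an intersection of two boxes, again a box.\<close>
  define h where "h x = indicat_real (box c d) x *\<^sub>R g x" for x
  have g_cbox: "set_integrable lebesgue (cbox c d) g"
    using g sub unfolding locally_integrable_def by (simp flip: integrable_set_lebesgue_eq)
  then have "set_integrable lebesgue (box c d) g"
    by (rule set_integrable_subset) (auto simp: box_subset_cbox)
  then have h: "integrable lebesgue h"
    by (simp add: set_integrable_def h_def[abs_def])
  have inside: "(LINT x:box a b|lebesgue. g x) = 0" if "box a b \<subseteq> box c d" for a b
  proof -
    obtain \<phi> :: "nat \<Rightarrow> 'a \<Rightarrow> real" where \<phi>: "\<And>n k. Ck k (\<phi> n)" "\<And>n x. 0 \<le> \<phi> n x" "\<And>n x. \<phi> n x \<le> 1"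
      "\<And>n x. x \<notin> box a b \<Longrightarrow> \<phi> n x = 0"
      "\<And>x. (\<lambda>n. \<phi> n x) \<longlonglongrightarrow> indicator (box a b) x"
      by (rule box_indicator_approx[of a b]) blast
    have sub': "x \<in> cbox c d" if "x \<in> box a b" for x
      using that \<open>box a b \<subseteq> box c d\<close> box_subset_cbox by blast
    have \<phi>0: "x \<in> \<Omega>" "x \<in> cbox c d" if "\<phi> n x \<noteq> 0" for n x
      using that \<phi>(4) sub sub' by blast+
    have "\<phi> n \<in> test_functions \<Omega>" for n
      by (rule test_functionsI[where K="cbox c d"]) (use \<phi>(1) sub in \<open>auto intro!: \<phi>(4) dest: sub'\<close>)
    then have "(LINT x|lebesgue_on \<Omega>. \<phi> n x *\<^sub>R g x) = 0" for n
      using zero by blast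
    moreover have "(LINT x|lebesgue_on \<Omega>. \<phi> n x *\<^sub>R g x)
        = (LINT x|lebesgue. \<phi> n x *\<^sub>R (indicat_real (cbox c d) x *\<^sub>R g x))" for n
      using \<open>open \<Omega>\<close> \<phi>0[of n]
      by (subst integral_restrict_space)
        (auto intro!: Bochner_Integration.integral_cong simp: indicator_def, blast)
    ultimately have int0: "(LINT x|lebesgue. \<phi> n x *\<^sub>R (indicat_real (cbox c d) x *\<^sub>R g x)) = 0" for n
      by simp
    have "(\<lambda>n. LINT x|lebesgue. \<phi> n x *\<^sub>R (indicat_real (cbox c d) x *\<^sub>R g x))
        \<longlonglongrightarrow> (LINT x|lebesgue. indicat_real (box a b) x *\<^sub>R (indicat_real (cbox c d) x *\<^sub>R g x))"
    proof (rule integral_dominated_convergence[where w="\<lambda>x. norm (indicat_real (cbox c d) x *\<^sub>R g x)"])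
      have g': "(\<lambda>x. indicat_real (cbox c d) x *\<^sub>R g x) \<in> borel_measurable lebesgue"
        using g_cbox unfolding set_integrable_def by (rule borel_measurable_integrable)
      then show "(\<lambda>x. indicat_real (box a b) x *\<^sub>R indicat_real (cbox c d) x *\<^sub>R g x) \<in> borel_measurable lebesgue"
        by (rule borel_measurable_scaleR[rotated]) (intro borel_measurable_indicator, auto)
      have "continuous_on UNIV (\<phi> n)" for n using \<phi>(1)[of 0 n] by simp
      then have "\<phi> n \<in> borel_measurable lebesgue" for n
        by (intro measurable_completion) (simp add: borel_measurable_continuous_onI)
      then show "(\<lambda>x. \<phi> n x *\<^sub>R indicat_real (cbox c d) x *\<^sub>R g x) \<in> borel_measurable lebesgue" for n
        using g' by (rule borel_measurable_scaleR)
      show "integrable lebesgue (\<lambda>x. norm (indicat_real (cbox c d) x *\<^sub>R g x))"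
        using g_cbox unfolding set_integrable_def by (rule integrable_norm)
      show "AE x in lebesgue. (\<lambda>n. \<phi> n x *\<^sub>R indicat_real (cbox c d) x *\<^sub>R g x)
          \<longlonglongrightarrow> indicat_real (box a b) x *\<^sub>R indicat_real (cbox c d) x *\<^sub>R g x"
        by (intro AE_I2 tendsto_scaleR \<phi> tendsto_const)
      show "AE x in lebesgue. norm (\<phi> n x *\<^sub>R indicat_real (cbox c d) x *\<^sub>R g x)
          \<le> norm (indicat_real (cbox c d) x *\<^sub>R g x)" for n
        using \<phi>(2,3) by (intro AE_I2) (simp add: mult.assoc mult_left_le_one_le)
    qed
    then have "(LINT x|lebesgue. indicat_real (box a b) x *\<^sub>R (indicat_real (cbox c d) x *\<^sub>R g x)) = 0"
      unfolding int0 by (simp add: LIMSEQ_const_iff)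
    moreover have "indicat_real (box a b) x *\<^sub>R (indicat_real (cbox c d) x *\<^sub>R g x)
        = indicat_real (box a b) x *\<^sub>R g x" for x
      using sub'[of x] by (auto simp: indicator_def)
    ultimately show ?thesis by (simp only: set_lebesgue_integral_def)
  qed
  have "AE x in lebesgue. h x = 0"
  proof (rule AE_zero_if_zero_on_boxes[OF h])
    show "(LINT x|lebesgue. h x) = 0"
      using inside[of c d] by (simp add: h_def set_lebesgue_integral_def)
    fix a b
    have "(LINT x:box a b|lebesgue. h x) = (LINT x:box a b \<inter> box c d|lebesgue. g x)"
      by (simp add: set_lebesgue_integral_def h_def indicator_inter_arith)
    moreover have "(LINT x:box a b \<inter> box c d|lebesgue. g x) = 0"
      unfolding box_Int_box by (intro inside) (simp flip: box_Int_box)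
    ultimately show "(LINT x:box a b|lebesgue. h x) = 0" by simp
  qed
  then show "AE x in lebesgue. x \<in> box c d \<longrightarrow> g x = 0"
    by eventually_elim (auto simp: h_def)
qed

section \<open>Weak gradients\<close>

lemma GDERIV_unique:
  assumes "GDERIV f x :> D" "GDERIV f x :> D'"
  shows "D = D'"
proof -
  have "(\<lambda>h. h \<bullet> D) = (\<lambda>h. h \<bullet> D')"
    using assms unfolding gderiv_def by (rule has_derivative_unique)
  then have "\<forall>h. h \<bullet> D = h \<bullet> D'" by meson
  then show ?thesis by (simp only: vector_eq_ldot)
qed

lemma gradient_eqI: "GDERIV f x :> D \<Longrightarrow> gradient f x = D"
  unfolding gradient_def by (blast intro: the_equality GDERIV_unique)

text \<open>\<open>Ck\<close> speaks of partial derivatives only; the coordinate formula carries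
  their continuity over to \<open>gradient\<close>.\<close>

lemma GDERIV_gradient:
  assumes "f differentiable at x"
  shows "GDERIV f x :> gradient f x"
    and "gradient f x = (\<Sum>b\<in>Basis. frechet_derivative f (at x) b *\<^sub>R b)"
proof -
  let ?D = "\<Sum>b\<in>Basis. frechet_derivative f (at x) b *\<^sub>R b"
  have f': "(f has_derivative frechet_derivative f (at x)) (at x)"
    using assms by (simp flip: frechet_derivative_works)
  have "frechet_derivative f (at x) h = h \<bullet> ?D" for h
  proof -
    have "frechet_derivative f (at x) h = frechet_derivative f (at x) (\<Sum>b\<in>Basis. (h \<bullet> b) *\<^sub>R b)"
      by (simp add: euclidean_representation)
    also have "\<dots> = (\<Sum>b\<in>Basis. (h \<bullet> b) * frechet_derivative f (at x) b)"
      using f'[THEN has_derivative_linear] by (simp add: linear_sum linear_scale)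
    finally show ?thesis by (simp add: inner_sum_right mult.commute)
  qed
  then have "frechet_derivative f (at x) = (\<lambda>h. h \<bullet> ?D)" by (rule ext)
  with f' have D: "GDERIV f x :> ?D" unfolding gderiv_def by simp
  then show "gradient f x = ?D" by (rule gradient_eqI)
  with D show "GDERIV f x :> gradient f x" by simp
qed

lemma test_function_differentiable: "\<phi> \<in> test_functions \<Omega> \<Longrightarrow> \<phi> differentiable at x"
  unfolding test_functions_def using Ck.simps(2)[of 0 \<phi>] by (auto simp: differentiable_on_def)

lemma test_function_continuous: "\<phi> \<in> test_functions \<Omega> \<Longrightarrow> continuous_on UNIV \<phi>"
  unfolding test_functions_def using Ck.simps(1)[of \<phi>] by blast

lemma test_function_gradient_continuous:
  assumes "\<phi> \<in> test_functions \<Omega>"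
  shows "continuous_on UNIV (gradient \<phi>)"
proof -
  have "Ck (Suc 0) \<phi>" using assms unfolding test_functions_def by blast
  then have "continuous_on UNIV (\<lambda>x. \<Sum>b\<in>Basis. frechet_derivative \<phi> (at x) b *\<^sub>R b)"
    by (intro continuous_intros) auto
  then show ?thesis
    by (simp add: GDERIV_gradient(2)[OF test_function_differentiable[OF assms], abs_def])
qed

lemma test_function_support:
  fixes \<phi> :: "'a::euclidean_space \<Rightarrow> real"
  assumes "\<phi> \<in> test_functions \<Omega>"
  obtains K where "compact K" "K \<subseteq> \<Omega>" "\<And>x. x \<notin> K \<Longrightarrow> \<phi> x = 0" "\<And>x. x \<notin> K \<Longrightarrow> gradient \<phi> x = 0"
proof
  let ?K = "closure {x. \<phi> x \<noteq> 0}"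
  show "compact ?K" "?K \<subseteq> \<Omega>" using assms unfolding test_functions_def by auto
  show zero: "\<phi> x = 0" if "x \<notin> ?K" for x using that closure_subset[of "{x. \<phi> x \<noteq> 0}"] by blast
  show "gradient \<phi> x = 0" if "x \<notin> ?K" for x
  proof (rule gradient_eqI)
    have "(\<phi> has_derivative (\<lambda>h. 0)) (at x)"
    proof (rule has_derivative_transform_within_open[OF has_derivative_const])
      show "open (- ?K)" by (intro open_Compl closed_closure)
      show "x \<in> - ?K" using that by simp
      show "0 = \<phi> y" if "y \<in> - ?K" for y using zero[of y] that by simp
    qed
    then show "GDERIV \<phi> x :> 0" by (simp add: gderiv_def)
  qed
qed

lemma test_functions_scale_add:
  assumes "\<phi> \<in> test_functions \<Omega>" "\<eta> \<in> test_functions \<Omega>"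
  shows "(\<lambda>x. a * \<phi> x + b * \<eta> x) \<in> test_functions \<Omega>"
proof -
  obtain K where K: "compact K" "K \<subseteq> \<Omega>" "\<And>x. x \<notin> K \<Longrightarrow> \<phi> x = 0"
    using test_function_support[OF assms(1)] by metis
  obtain K' where K': "compact K'" "K' \<subseteq> \<Omega>" "\<And>x. x \<notin> K' \<Longrightarrow> \<eta> x = 0"
    using test_function_support[OF assms(2)] by metis
  show ?thesis
  proof (rule test_functionsI)
    show "Ck k (\<lambda>x. a * \<phi> x + b * \<eta> x)" for k
      using assms unfolding test_functions_def by (auto intro!: Ck_add Ck_mult Ck_const)
    show "compact (K \<union> K')" "K \<union> K' \<subseteq> \<Omega>" using K K' by (auto intro: compact_Un)
  qed (use K K' in auto)
qed

lemma continuous_compact_support_bounded: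
  fixes f :: "'a::euclidean_space \<Rightarrow> 'b::real_normed_vector"
  assumes "continuous_on UNIV f" "compact K" "\<And>x. x \<notin> K \<Longrightarrow> f x = 0"
  obtains B where "\<And>x. norm (f x) \<le> B" "0 \<le> B"
proof -
  have "compact (f ` K)" using assms by (auto intro: compact_continuous_image continuous_on_subset)
  then obtain B where B: "\<And>x. x \<in> K \<Longrightarrow> norm (f x) \<le> B"
    by (metis compact_imp_bounded bounded_iff image_eqI)
  \<comment> \<open>For empty K the bound B is arbitrary and may be negative.\<close>
  have "norm (f x) \<le> max B 0" for x
    using B[of x] assms(3)[of x] by (cases "x \<in> K") auto
  then show thesis using that[of "max B 0"] by auto
qed

text \<open>Local integrability controls f on K alone. Since \<phi> vanishes off K, f may be
  replaced by its product with the indicator of K, which is integrable on the whole space.\<close>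

lemma integrable_compact_support:
  fixes \<phi> :: "'a::euclidean_space \<Rightarrow> real" and f :: "'a \<Rightarrow> 'b::euclidean_space"
  assumes "open \<Omega>" "locally_integrable \<Omega> f" "continuous_on UNIV \<phi>" "compact K" "K \<subseteq> \<Omega>"
    "\<And>x. x \<notin> K \<Longrightarrow> \<phi> x = 0"
  shows "integrable (lebesgue_on \<Omega>) (\<lambda>x. \<phi> x *\<^sub>R f x)"
proof -
  obtain B where B: "\<And>x. norm (\<phi> x) \<le> B"
    using continuous_compact_support_bounded assms by metis
  have fK: "integrable lebesgue (\<lambda>x. indicat_real K x *\<^sub>R f x)"
    using assms unfolding locally_integrable_def
    by (simp add: integrable_set_lebesgue_eq(1) set_integrable_def lmeasurable_compact fmeasurableD)
  have "\<phi> \<in> borel_measurable lebesgue"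
    using assms(3) by (intro measurable_completion) (simp add: borel_measurable_continuous_onI)
  then have "integrable lebesgue (\<lambda>x. \<phi> x *\<^sub>R (indicat_real K x *\<^sub>R f x))"
  proof (intro Bochner_Integration.integrable_bound[OF integrable_scaleR_right[OF fK, of B]])
    show "(\<lambda>x. \<phi> x *\<^sub>R indicat_real K x *\<^sub>R f x) \<in> borel_measurable lebesgue"
      using \<open>\<phi> \<in> _\<close> fK[THEN borel_measurable_integrable] by (rule borel_measurable_scaleR)
    have "\<bar>\<phi> x\<bar> \<le> \<bar>B\<bar>" for x using B[of x] by simp
    then show "AE x in lebesgue. norm (\<phi> x *\<^sub>R indicat_real K x *\<^sub>R f x) \<le> norm (B *\<^sub>R indicat_real K x *\<^sub>R f x)"
      unfolding norm_scaleR by (intro AE_I2 mult_right_mono) auto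
  qed
  moreover have "\<phi> x *\<^sub>R (indicat_real K x *\<^sub>R f x) = indicat_real \<Omega> x *\<^sub>R (\<phi> x *\<^sub>R f x)" for x
    using assms(5) assms(6)[of x] by (auto simp: indicator_def)
  ultimately have "integrable lebesgue (\<lambda>x. indicat_real \<Omega> x *\<^sub>R (\<phi> x *\<^sub>R f x))"
    by (simp only:)
  then show ?thesis
    using \<open>open \<Omega>\<close> by (subst integrable_restrict_space) auto
qed

lemma integrable_test_function:
  assumes "open \<Omega>" "locally_integrable \<Omega> f" "\<phi> \<in> test_functions \<Omega>"
  shows "integrable (lebesgue_on \<Omega>) (\<lambda>x. \<phi> x *\<^sub>R f x)"
proof -
  obtain K where "compact K" "K \<subseteq> \<Omega>" "\<And>x. x \<notin> K \<Longrightarrow> \<phi> x = 0"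
    using test_function_support[OF assms(3)] by metis
  then show ?thesis
    by (rule integrable_compact_support[OF assms(1,2) test_function_continuous[OF assms(3)]])
qed

text \<open>Here the compactly supported factor is the vector and f the scalar, so each component of
  the gradient takes the role of \<phi> in \<open>integrable_compact_support\<close>.\<close>

lemma integrable_test_gradient:
  fixes f :: "'a::euclidean_space \<Rightarrow> real"
  assumes "open \<Omega>" "locally_integrable \<Omega> f" "\<phi> \<in> test_functions \<Omega>"
  shows "integrable (lebesgue_on \<Omega>) (\<lambda>x. f x *\<^sub>R gradient \<phi> x)"
proof -
  obtain K where K: "compact K" "K \<subseteq> \<Omega>" "\<And>x. x \<notin> K \<Longrightarrow> gradient \<phi> x = 0"
    using test_function_support[OF assms(3)] by metis
  have "integrable (lebesgue_on \<Omega>) (\<lambda>x. (gradient \<phi> x \<bullet> b) *\<^sub>R f x)" if "b \<in> Basis" for b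
    by (rule integrable_compact_support[OF assms(1,2) _ K(1,2)])
       (use K test_function_gradient_continuous[OF assms(3)] in \<open>auto intro!: continuous_intros\<close>)
  then have "integrable (lebesgue_on \<Omega>) (\<lambda>x. \<Sum>b\<in>Basis. ((gradient \<phi> x \<bullet> b) *\<^sub>R f x) *\<^sub>R b)"
    by (intro Bochner_Integration.integrable_sum integrable_scaleR_left) auto
  moreover have "(\<Sum>b\<in>Basis. ((gradient \<phi> x \<bullet> b) *\<^sub>R f x) *\<^sub>R b) = f x *\<^sub>R gradient \<phi> x" for x
    by (subst (2) euclidean_representation[symmetric]) (simp add: scaleR_sum_right mult.commute)
  ultimately show ?thesis by simp
qed

section \<open>Linearity and uniqueness of weak gradients\<close>

lemma locally_integrable_scale_add:
  "locally_integrable \<Omega> f \<Longrightarrow> locally_integrable \<Omega> g \<Longrightarrow>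
    locally_integrable \<Omega> (\<lambda>x. a *\<^sub>R f x + b *\<^sub>R g x)"
  unfolding locally_integrable_def by (auto intro!: Bochner_Integration.integrable_add integrable_scaleR_right)

lemma has_weak_gradient_scale_add:
  assumes "open \<Omega>" and u: "has_weak_gradient \<Omega> u g" and v: "has_weak_gradient \<Omega> v h"
  shows "has_weak_gradient \<Omega> (\<lambda>x. a * u x + b * v x) (\<lambda>x. a *\<^sub>R g x + b *\<^sub>R h x)"
  unfolding has_weak_gradient_def
proof (intro conjI ballI)
  have li: "locally_integrable \<Omega> u" "locally_integrable \<Omega> v" "locally_integrable \<Omega> g" "locally_integrable \<Omega> h"
    using u v unfolding has_weak_gradient_def by auto
  show "locally_integrable \<Omega> (\<lambda>x. a * u x + b * v x)"
    using locally_integrable_scale_add[OF li(1,2), of a b] by simp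
  show "locally_integrable \<Omega> (\<lambda>x. a *\<^sub>R g x + b *\<^sub>R h x)"
    by (rule locally_integrable_scale_add[OF li(3,4)])
  fix \<phi> assume \<phi>: "\<phi> \<in> test_functions \<Omega>"
  note [simp] = integrable_test_gradient[OF \<open>open \<Omega>\<close> _ \<phi>] integrable_test_function[OF \<open>open \<Omega>\<close> _ \<phi>] li
  have "(LINT x|lebesgue_on \<Omega>. (a * u x + b * v x) *\<^sub>R gradient \<phi> x)
      = (LINT x|lebesgue_on \<Omega>. a *\<^sub>R (u x *\<^sub>R gradient \<phi> x) + b *\<^sub>R (v x *\<^sub>R gradient \<phi> x))"
    by (simp add: algebra_simps)
  also have "\<dots> = a *\<^sub>R (LINT x|lebesgue_on \<Omega>. u x *\<^sub>R gradient \<phi> x)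
      + b *\<^sub>R (LINT x|lebesgue_on \<Omega>. v x *\<^sub>R gradient \<phi> x)"
    by (subst Bochner_Integration.integral_add) (simp_all del: scaleR_scaleR)
  also have "\<dots> = - (a *\<^sub>R (LINT x|lebesgue_on \<Omega>. \<phi> x *\<^sub>R g x) + b *\<^sub>R (LINT x|lebesgue_on \<Omega>. \<phi> x *\<^sub>R h x))"
    using u v \<phi> unfolding has_weak_gradient_def by simp
  also have "a *\<^sub>R (LINT x|lebesgue_on \<Omega>. \<phi> x *\<^sub>R g x) + b *\<^sub>R (LINT x|lebesgue_on \<Omega>. \<phi> x *\<^sub>R h x)
      = (LINT x|lebesgue_on \<Omega>. a *\<^sub>R (\<phi> x *\<^sub>R g x) + b *\<^sub>R (\<phi> x *\<^sub>R h x))"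
    by (subst Bochner_Integration.integral_add) (simp_all del: scaleR_scaleR)
  also have "\<dots> = (LINT x|lebesgue_on \<Omega>. \<phi> x *\<^sub>R (a *\<^sub>R g x + b *\<^sub>R h x))"
    by (simp add: algebra_simps)
  finally show "(LINT x|lebesgue_on \<Omega>. (a * u x + b * v x) *\<^sub>R gradient \<phi> x)
      = - (LINT x|lebesgue_on \<Omega>. \<phi> x *\<^sub>R (a *\<^sub>R g x + b *\<^sub>R h x))" .
qed

text \<open>With coefficients 1 and -1 the difference g - h becomes a weak gradient of the zero
  function, so it integrates to 0 against every test function.\<close>

lemma has_weak_gradient_unique:
  assumes "open \<Omega>" and g: "has_weak_gradient \<Omega> u g" and h: "has_weak_gradient \<Omega> u h"
  shows "AE x in lebesgue_on \<Omega>. g x = h x"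
proof -
  have d: "has_weak_gradient \<Omega> (\<lambda>x. 1 * u x + (-1) * u x) (\<lambda>x. 1 *\<^sub>R g x + (-1) *\<^sub>R h x)"
    by (rule has_weak_gradient_scale_add[OF assms])
  have "AE x in lebesgue_on \<Omega>. 1 *\<^sub>R g x + (-1) *\<^sub>R h x = 0"
  proof (rule fundamental_lemma[OF \<open>open \<Omega>\<close>])
    show "locally_integrable \<Omega> (\<lambda>x. 1 *\<^sub>R g x + (-1) *\<^sub>R h x)"
      using d unfolding has_weak_gradient_def by blast
    show "(LINT x|lebesgue_on \<Omega>. \<phi> x *\<^sub>R (1 *\<^sub>R g x + (-1) *\<^sub>R h x)) = 0"
      if "\<phi> \<in> test_functions \<Omega>" for \<phi>
      using d that unfolding has_weak_gradient_def by simp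
  qed
  then show ?thesis by eventually_elim simp
qed

lemma weakly_differentiable_weak_grad:
  "weakly_differentiable \<Omega> u \<Longrightarrow> has_weak_gradient \<Omega> u (weak_grad \<Omega> u)"
  unfolding weakly_differentiable_def weak_grad_def by (rule someI_ex[of "has_weak_gradient \<Omega> u"])

text \<open>This makes the choice in \<open>weak_grad\<close> harmless: every later formula for the
  weak gradient of a specific function is obtained here, and therefore holds almost
  everywhere.\<close>

lemma weak_grad_AE_eq:
  assumes "open \<Omega>" "has_weak_gradient \<Omega> u g"
  shows "AE x in lebesgue_on \<Omega>. weak_grad \<Omega> u x = g x"
  using assms weakly_differentiable_weak_grad weakly_differentiable_def has_weak_gradient_unique
  by metis

section \<open>Integration by parts for test functions\<close>

lemma test_functions_mult:
  assumes "\<phi> \<in> test_functions \<Omega>" "\<eta> \<in> test_functions \<Omega>"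
  shows "(\<lambda>x. \<phi> x * \<eta> x) \<in> test_functions \<Omega>"
proof -
  obtain K where K: "compact K" "K \<subseteq> \<Omega>" "\<And>x. x \<notin> K \<Longrightarrow> \<phi> x = 0"
    using test_function_support[OF assms(1)] by metis
  have "\<And>k. Ck k (\<lambda>x. \<phi> x * \<eta> x)"
    using assms unfolding test_functions_def by (auto intro!: Ck_mult)
  then show ?thesis
    using K(1,2) by (rule test_functionsI) (simp add: K(3))
qed

lemma gradient_mult:
  assumes "f differentiable at x" "g differentiable at x"
  shows "gradient (\<lambda>x. f x * g x) x = f x *\<^sub>R gradient g x + g x *\<^sub>R gradient f x"
proof (rule gradient_eqI)
  show "GDERIV (\<lambda>x. f x * g x) x :> f x *\<^sub>R gradient g x + g x *\<^sub>R gradient f x"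
    using assms[THEN GDERIV_gradient(1)] by (rule GDERIV_mult)
qed

lemma continuous_compact_support_integrable:
  fixes f :: "'a::euclidean_space \<Rightarrow> 'b::euclidean_space"
  assumes "continuous_on UNIV f" "compact K" "\<And>x. x \<notin> K \<Longrightarrow> f x = 0"
  shows "integrable lborel f"
proof -
  have "integrable lborel (\<lambda>x. indicator K x *\<^sub>R f x)"
    using assms by (intro borel_integrable_compact) (auto intro: continuous_on_subset)
  moreover have "indicator K x *\<^sub>R f x = f x" for x
    using assms(3)[of x] by (cases "x \<in> K") auto
  ultimately show ?thesis by simp
qed

text \<open>Difference quotients along the steps 1/(n+1), as a sequence, ready for dominated
  convergence. They serve twice: for integration by parts and for the first variation.\<close>

lemma GDERIV_directional_sequence:
  assumes "GDERIV f x :> D"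
  shows "(\<lambda>n. real (Suc n) * (f (x + (1 / real (Suc n)) *\<^sub>R b) - f x)) \<longlonglongrightarrow> D \<bullet> b"
proof -
  have "((\<lambda>r. f (x + r *\<^sub>R b)) has_real_derivative D \<bullet> b) (at 0)"
  proof -
    have "((\<lambda>r. x + r *\<^sub>R b) has_derivative (\<lambda>r. r *\<^sub>R b)) (at 0)"
      by (auto intro!: derivative_eq_intros)
    moreover have "(f has_derivative (\<lambda>h. h \<bullet> D)) (at (x + 0 *\<^sub>R b))"
      using assms by (simp add: gderiv_def)
    ultimately have "((\<lambda>r. f (x + r *\<^sub>R b)) has_derivative (\<lambda>r. (r *\<^sub>R b) \<bullet> D)) (at 0)"
      by (rule has_derivative_compose)
    moreover have "(\<lambda>r. (r *\<^sub>R b) \<bullet> D) = (\<lambda>r. (D \<bullet> b) * r)"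
      by (simp add: fun_eq_iff inner_commute)
    ultimately show ?thesis
      by (simp add: has_field_derivative_def)
  qed
  then have "((\<lambda>h. (f (x + h *\<^sub>R b) - f x) / h) \<longlongrightarrow> D \<bullet> b) (at 0)"
    by (simp add: DERIV_def)
  moreover have "filterlim (\<lambda>n. 1 / real (Suc n)) (at 0) sequentially"
    by (rule filterlim_atI[OF LIMSEQ_Suc[OF lim_1_over_n]]) simp
  ultimately have "(\<lambda>n. (f (x + (1 / real (Suc n)) *\<^sub>R b) - f x) / (1 / real (Suc n)))
      \<longlonglongrightarrow> D \<bullet> b"
    by (rule filterlim_compose)
  then show ?thesis by (simp add: mult.commute)
qed

text \<open>By translation invariance w(x + t b) - w(x) integrates to 0 for every t, and the
  difference quotients converge to the partial derivative under a fixed bound; iterated integrals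
  are avoided. The computation uses \<open>lborel\<close>, and completion leaves the integral of a
  Borel function unchanged.\<close>

lemma integral_gradient_test_function:
  fixes w :: "'a::euclidean_space \<Rightarrow> real"
  assumes w: "w \<in> test_functions \<Omega>"
  shows "(LINT x|lebesgue. gradient w x) = 0"
proof -
  obtain K where K: "compact K" "K \<subseteq> \<Omega>" "\<And>x. x \<notin> K \<Longrightarrow> w x = 0" "\<And>x. x \<notin> K \<Longrightarrow> gradient w x = 0"
    using test_function_support[OF w] by metis
  note cont = test_function_continuous[OF w] test_function_gradient_continuous[OF w]
  have int_w: "integrable lborel w"
    using cont(1) K(1,3) by (rule continuous_compact_support_integrable)
  have int_grad: "integrable lborel (gradient w)"
    using cont(2) K(1,4) by (rule continuous_compact_support_integrable)
  obtain R where R: "\<And>x. x \<in> K \<Longrightarrow> norm x \<le> R"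
    using compact_imp_bounded[OF K(1)] by (auto simp: bounded_iff)
  obtain B where B: "\<And>x. norm (gradient w x) \<le> B" "0 \<le> B"
    using continuous_compact_support_bounded[OF cont(2) K(1,4)] by metis
  have der: "(w has_derivative (\<lambda>h. h \<bullet> gradient w x)) (at x)" for x
    using GDERIV_gradient(1)[OF test_function_differentiable[OF w]] unfolding gderiv_def .
  have lip: "\<bar>w x - w y\<bar> \<le> B * norm (x - y)" for x y
  proof -
    have "norm (w x - w y) \<le> B * norm (x - y)"
    proof (rule differentiable_bound[of UNIV])
      show "(w has_derivative (\<lambda>h. h \<bullet> gradient w x)) (at x within UNIV)" for x
        using der by simp
      show "onorm (\<lambda>h. h \<bullet> gradient w x) \<le> B" for x
      proof (rule onorm_le)
        fix h :: 'a
        have "\<bar>h \<bullet> gradient w x\<bar> \<le> norm h * norm (gradient w x)" by (rule Cauchy_Schwarz_ineq2)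
        also have "\<dots> \<le> B * norm h" using B(1)[of x] by (subst mult.commute) (rule mult_right_mono, auto)
        finally show "norm (h \<bullet> gradient w x) \<le> B * norm h" by simp
      qed
    qed auto
    then show ?thesis by simp
  qed
  have "(LINT x|lborel. gradient w x \<bullet> b) = 0" if b: "b \<in> Basis" for b
  proof -
    define s where "s n x = real (Suc n) * (w (x + (1 / real (Suc n)) *\<^sub>R b) - w x)" for n x
    have "(\<lambda>n. LINT x|lborel. s n x) \<longlonglongrightarrow> (LINT x|lborel. gradient w x \<bullet> b)"
    \<comment> \<open>B is a Lipschitz constant of w and hence bounds every quotient. All steps have
      length at most 1, so for |x| > R + 1 both x and the shifted point miss the support K, which
      lies in the ball of radius R.\<close>
    proof (rule integral_dominated_convergence[where w="\<lambda>x. indicat_real (cball 0 (R + 1)) x *\<^sub>R B"])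
      show "(\<lambda>x. gradient w x \<bullet> b) \<in> borel_measurable lborel" "s n \<in> borel_measurable lborel" for n
        unfolding s_def[abs_def] measurable_lborel1
        by (auto intro!: borel_measurable_continuous_onI continuous_intros cont
            continuous_on_compose2[OF cont(1)])
      show "integrable lborel (\<lambda>x::'a. indicat_real (cball 0 (R + 1)) x *\<^sub>R B)"
        by (intro borel_integrable_compact) auto
      show "AE x in lborel. (\<lambda>n. s n x) \<longlonglongrightarrow> gradient w x \<bullet> b"
      proof (rule AE_I2)
        fix x
        show "(\<lambda>n. s n x) \<longlonglongrightarrow> gradient w x \<bullet> b"
          unfolding s_def
          by (rule GDERIV_directional_sequence[OF GDERIV_gradient(1)[OF test_function_differentiable[OF w]]])
      qed
      show "AE x in lborel. norm (s n x) \<le> indicat_real (cball 0 (R + 1)) x *\<^sub>R B" for n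
      proof (rule AE_I2)
        fix x :: 'a
        have h: "norm ((1 / real (Suc n)) *\<^sub>R b) = 1 / real (Suc n)" "1 / real (Suc n) \<le> 1"
          using b by auto
        show "norm (s n x) \<le> indicat_real (cball 0 (R + 1)) x *\<^sub>R B"
        proof (cases "norm x \<le> R + 1")
          case True
          have "\<bar>w (x + (1 / real (Suc n)) *\<^sub>R b) - w x\<bar> \<le> B * (1 / real (Suc n))"
            using lip[of "x + (1 / real (Suc n)) *\<^sub>R b" x] h(1) by (metis add_diff_cancel_left')
          then have "real (Suc n) * \<bar>w (x + (1 / real (Suc n)) *\<^sub>R b) - w x\<bar>
              \<le> real (Suc n) * (B * (1 / real (Suc n)))"
            by (intro mult_left_mono) auto
          then have "real (Suc n) * \<bar>w (x + (1 / real (Suc n)) *\<^sub>R b) - w x\<bar> \<le> B"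
            by (simp del: of_nat_Suc)
          with True show ?thesis by (simp add: s_def abs_mult del: of_nat_Suc)
        next
          case False
          have "R < norm (x + (1 / real (Suc n)) *\<^sub>R b)"
            using False h norm_triangle_ineq4[of "x + (1 / real (Suc n)) *\<^sub>R b" "(1 / real (Suc n)) *\<^sub>R b"]
            unfolding add_diff_cancel_right' by linarith
          then have "w (x + (1 / real (Suc n)) *\<^sub>R b) = 0" using K(3) R by (meson not_le)
          moreover have "w x = 0" using False K(3)[of x] R[of x] by linarith
          ultimately show ?thesis using False by (simp add: s_def)
        qed
      qed
    qed
    moreover have "(LINT x|lborel. s n x) = 0" for n
    proof -
      define c where "c = (1 / real (Suc n)) *\<^sub>R b"
      have w_borel: "w \<in> borel_measurable borel"
        using cont(1) by (rule borel_measurable_continuous_onI)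
      have "integrable (distr lborel borel ((+) c)) w"
        using int_w by (simp add: lborel_distr_plus)
      then have shift: "integrable lborel (\<lambda>x. w (c + x))"
        by (subst (asm) integrable_distr_eq) (use w_borel in auto)
      have "(LINT x|distr lborel borel ((+) c). w x) = (LINT x|lborel. w (c + x))"
        by (rule integral_distr) (use w_borel in auto)
      then have "(LINT x|lborel. w (c + x)) = (LINT x|lborel. w x)"
        by (simp add: lborel_distr_plus)
      then have "(LINT x|lborel. w (c + x) - w x) = 0"
        using shift int_w by simp
      then show ?thesis
        unfolding s_def c_def[symmetric] by (simp add: add.commute)
    qed
    ultimately show ?thesis by (simp add: LIMSEQ_const_iff)
  qed
  then have "(LINT x|lborel. gradient w x) \<bullet> b = 0" if "b \<in> Basis" for b
    using int_grad that by simp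
  then have "(LINT x|lborel. gradient w x) = 0"
    using euclidean_all_zero_iff by blast
  then show ?thesis
    using int_grad by (subst integral_completion) auto
qed

lemma continuous_imp_locally_integrable:
  fixes f :: "'a::euclidean_space \<Rightarrow> 'b::euclidean_space"
  assumes "continuous_on UNIV f"
  shows "locally_integrable \<Omega> f"
  unfolding locally_integrable_def
proof (intro allI impI)
  fix K assume "compact K \<and> K \<subseteq> \<Omega>"
  then have K: "compact K" by simp
  then have "integrable lborel (\<lambda>x. indicator K x *\<^sub>R f x)"
    using assms by (intro borel_integrable_compact) (auto intro: continuous_on_subset)
  then have "integrable lebesgue (\<lambda>x. indicator K x *\<^sub>R f x)"
    by (subst integrable_completion) auto
  with K show "integrable (lebesgue_on K) f"
    by (simp add: integrable_set_lebesgue_eq(1) set_integrable_def lmeasurable_compact fmeasurableD)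
qed

text \<open>The product of the two test functions is again a test function, so its gradient
  integrates to 0; the product rule splits that integral into the two sides of the
  definition.\<close>

lemma has_weak_gradient_test_function:
  assumes "open \<Omega>" and \<phi>: "\<phi> \<in> test_functions \<Omega>"
  shows "has_weak_gradient \<Omega> \<phi> (gradient \<phi>)"
  unfolding has_weak_gradient_def
proof (intro conjI ballI)
  show li: "locally_integrable \<Omega> \<phi>"
    by (intro continuous_imp_locally_integrable test_function_continuous[OF \<phi>])
  show li': "locally_integrable \<Omega> (gradient \<phi>)"
    by (intro continuous_imp_locally_integrable test_function_gradient_continuous[OF \<phi>])
  fix \<eta> assume \<eta>: "\<eta> \<in> test_functions \<Omega>"
  have grad: "gradient (\<lambda>x. \<phi> x * \<eta> x) x = \<phi> x *\<^sub>R gradient \<eta> x + \<eta> x *\<^sub>R gradient \<phi> x" for x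
    by (intro gradient_mult test_function_differentiable[OF \<phi>] test_function_differentiable[OF \<eta>])
  obtain K where K: "K \<subseteq> \<Omega>" "\<And>x. x \<notin> K \<Longrightarrow> gradient (\<lambda>x. \<phi> x * \<eta> x) x = 0"
    using test_function_support[OF test_functions_mult[OF \<phi> \<eta>]] by metis
  have "(LINT x|lebesgue_on \<Omega>. \<phi> x *\<^sub>R gradient \<eta> x) + (LINT x|lebesgue_on \<Omega>. \<eta> x *\<^sub>R gradient \<phi> x)
      = (LINT x|lebesgue_on \<Omega>. gradient (\<lambda>x. \<phi> x * \<eta> x) x)"
    unfolding grad
    by (intro Bochner_Integration.integral_add[symmetric] integrable_test_gradient[OF \<open>open \<Omega>\<close> li \<eta>]
        integrable_test_function[OF \<open>open \<Omega>\<close> li' \<eta>])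
  also have "\<dots> = (LINT x|lebesgue. indicat_real \<Omega> x *\<^sub>R gradient (\<lambda>x. \<phi> x * \<eta> x) x)"
    using \<open>open \<Omega>\<close> by (intro integral_restrict_space) auto
  also have "\<dots> = (LINT x|lebesgue. gradient (\<lambda>x. \<phi> x * \<eta> x) x)"
  proof (rule Bochner_Integration.integral_cong[OF refl])
    show "indicat_real \<Omega> x *\<^sub>R gradient (\<lambda>x. \<phi> x * \<eta> x) x = gradient (\<lambda>x. \<phi> x * \<eta> x) x" for x
      using K by (cases "x \<in> \<Omega>") auto
  qed
  also have "\<dots> = 0"
    by (rule integral_gradient_test_function[OF test_functions_mult[OF \<phi> \<eta>]])
  finally show "(LINT x|lebesgue_on \<Omega>. \<phi> x *\<^sub>R gradient \<eta> x) = - (LINT x|lebesgue_on \<Omega>. \<eta> x *\<^sub>R gradient \<phi> x)"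
    by (simp add: eq_neg_iff_add_eq_0)
qed

section \<open>Sobolev functions\<close>

text \<open>f is integrable, hence measurable, on each of countably many closed boxes that cover
  \<Omega>; measurability is local for such a cover.\<close>

lemma locally_integrable_measurable:
  fixes f :: "'a::euclidean_space \<Rightarrow> 'b::euclidean_space"
  assumes "open \<Omega>" "locally_integrable \<Omega> f"
  shows "f \<in> borel_measurable (lebesgue_on \<Omega>)"
proof -
  obtain \<D> where \<D>: "countable \<D>" "\<D> \<subseteq> Pow \<Omega>" "\<And>X. X \<in> \<D> \<Longrightarrow> \<exists>a b. X = cbox a b" "\<Union>\<D> = \<Omega>"
    using open_countable_Union_open_cbox[OF \<open>open \<Omega>\<close>] by metis
  show ?thesis
  proof (rule measurable_piecewise_restrict[OF \<D>(1)])
    show "space (lebesgue_on \<Omega>) \<subseteq> \<Union>\<D>" using \<D>(4) by simp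
    fix X assume X: "X \<in> \<D>"
    then obtain a b where ab: "X = cbox a b" using \<D>(3) by meson
    have sub: "X \<subseteq> \<Omega>" using X \<D>(2) by blast
    show "X \<inter> space (lebesgue_on \<Omega>) \<in> sets (lebesgue_on \<Omega>)"
      using sub \<open>open \<Omega>\<close> by (subst sets_restrict_space_iff) (auto simp: ab Int_absorb2)
    have "integrable (lebesgue_on X) f"
      using assms(2) sub unfolding locally_integrable_def ab by (meson compact_cbox)
    moreover have "restrict_space (lebesgue_on \<Omega>) X = lebesgue_on X"
      using sub \<open>open \<Omega>\<close> by (simp add: restrict_restrict_space ab Int_absorb1)
    ultimately show "f \<in> borel_measurable (restrict_space (lebesgue_on \<Omega>) X)"
      by (simp add: borel_measurable_integrable)
  qed
qed

text \<open>Convexity of the power is applied at positive arguments. When s or r is 0, the claim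
  reduces to c^p \<le> c for 0 \<le> c \<le> 1, which is \<open>scale\<close>.\<close>

lemma powr_convex_combination:
  fixes s r t p :: real
  assumes "1 \<le> p" "0 \<le> s" "0 \<le> r" "0 \<le> t" "t \<le> 1"
  shows "((1 - t) * s + t * r) powr p \<le> (1 - t) * s powr p + t * r powr p"
proof -
  have scale: "(c * y) powr p \<le> c * y powr p" if "0 \<le> c" "c \<le> 1" "0 \<le> y" for c y :: real
  proof -
    have "c powr p \<le> c"
      using powr_mono'[of 1 p c] that \<open>1 \<le> p\<close> by simp
    then show ?thesis using that by (simp add: powr_mult mult_right_mono)
  qed
  consider "s = 0" | "r = 0" | "0 < s" "0 < r" using assms by linarith
  then show ?thesis
  proof cases
    case 1 then show ?thesis using scale[of t r] assms by simp
  next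
    case 2 then show ?thesis using scale[of "1 - t" s] assms by simp
  next
    case 3
    then show ?thesis
      using convex_onD[OF powr_convex[OF \<open>1 \<le> p\<close>], of t s r] assms by simp
  qed
qed

lemma norm_powr_convex_combination:
  fixes x y :: "'a::real_normed_vector"
  assumes "1 \<le> p" "0 \<le> t" "t \<le> 1"
  shows "norm ((1 - t) *\<^sub>R x + t *\<^sub>R y) powr p \<le> (1 - t) * norm x powr p + t * norm y powr p"
proof -
  have "norm ((1 - t) *\<^sub>R x + t *\<^sub>R y) \<le> (1 - t) * norm x + t * norm y"
    using norm_triangle_ineq[of "(1 - t) *\<^sub>R x" "t *\<^sub>R y"] assms by simp
  then have "norm ((1 - t) *\<^sub>R x + t *\<^sub>R y) powr p \<le> ((1 - t) * norm x + t * norm y) powr p"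
    using assms by (intro powr_mono2) auto
  also have "\<dots> \<le> (1 - t) * norm x powr p + t * norm y powr p"
    using assms by (intro powr_convex_combination) auto
  finally show ?thesis .
qed

text \<open>A sum is at most twice the larger term, and a power of the maximum is at most the sum of
  the powers. This crude bound is enough for closure of \<open>Lp\<close> under linear combinations
  and holds for every p \<ge> 0.\<close>

lemma norm_powr_scale_add_le:
  fixes x y :: "'a::real_normed_vector"
  assumes "0 \<le> p"
  shows "norm (a *\<^sub>R x + b *\<^sub>R y) powr p
    \<le> (2 * \<bar>a\<bar>) powr p * norm x powr p + (2 * \<bar>b\<bar>) powr p * norm y powr p"
proof -
  let ?m = "max (\<bar>a\<bar> * norm x) (\<bar>b\<bar> * norm y)"
  have "norm (a *\<^sub>R x + b *\<^sub>R y) \<le> \<bar>a\<bar> * norm x + \<bar>b\<bar> * norm y"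
    using norm_triangle_ineq[of "a *\<^sub>R x" "b *\<^sub>R y"] by simp
  then have "norm (a *\<^sub>R x + b *\<^sub>R y) \<le> 2 * ?m" by linarith
  then have "norm (a *\<^sub>R x + b *\<^sub>R y) powr p \<le> (2 * ?m) powr p"
    using assms by (intro powr_mono2) auto
  also have "\<dots> \<le> (2 * (\<bar>a\<bar> * norm x)) powr p + (2 * (\<bar>b\<bar> * norm y)) powr p"
    by (cases "\<bar>a\<bar> * norm x \<le> \<bar>b\<bar> * norm y") (auto simp: max_def)
  finally show ?thesis by (simp add: powr_mult mult.assoc)
qed

lemma Lp_scale_add:
  assumes "0 \<le> p" "f \<in> Lp \<Omega> p" "g \<in> Lp \<Omega> p"
  shows "(\<lambda>x. a *\<^sub>R f x + b *\<^sub>R g x) \<in> Lp \<Omega> p"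
proof -
  have [measurable]: "f \<in> borel_measurable (lebesgue_on \<Omega>)" "g \<in> borel_measurable (lebesgue_on \<Omega>)"
    and int: "integrable (lebesgue_on \<Omega>) (\<lambda>x. norm (f x) powr p)"
      "integrable (lebesgue_on \<Omega>) (\<lambda>x. norm (g x) powr p)"
    using assms unfolding Lp_def by auto
  have "integrable (lebesgue_on \<Omega>) (\<lambda>x. norm (a *\<^sub>R f x + b *\<^sub>R g x) powr p)"
  proof (rule Bochner_Integration.integrable_bound)
    show "integrable (lebesgue_on \<Omega>) (\<lambda>x. (2 * \<bar>a\<bar>) powr p * norm (f x) powr p
        + (2 * \<bar>b\<bar>) powr p * norm (g x) powr p)"
      using int by (intro Bochner_Integration.integrable_add integrable_mult_right)
    show "AE x in lebesgue_on \<Omega>. norm (norm (a *\<^sub>R f x + b *\<^sub>R g x) powr p)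
        \<le> norm ((2 * \<bar>a\<bar>) powr p * norm (f x) powr p + (2 * \<bar>b\<bar>) powr p * norm (g x) powr p)"
      using norm_powr_scale_add_le[OF \<open>0 \<le> p\<close>] by (intro AE_I2) (auto intro: order_trans[OF _ abs_ge_self])
  qed measurable
  then show ?thesis unfolding Lp_def by simp
qed

lemma weak_grad_measurable:
  "open \<Omega> \<Longrightarrow> weakly_differentiable \<Omega> u \<Longrightarrow> weak_grad \<Omega> u \<in> borel_measurable (lebesgue_on \<Omega>)"
  using weakly_differentiable_weak_grad[of \<Omega> u] locally_integrable_measurable
  unfolding has_weak_gradient_def by blast

text \<open>Any p-integrable weak gradient certifies membership, since the representative in
  \<open>W1p\<close> agrees with it almost everywhere.\<close>

lemma W1pI:
  assumes "open \<Omega>" "u \<in> Lp \<Omega> p" "has_weak_gradient \<Omega> u g" "g \<in> Lp \<Omega> p"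
  shows "u \<in> W1p \<Omega> p"
proof -
  have wd: "weakly_differentiable \<Omega> u" using assms(3) unfolding weakly_differentiable_def by blast
  note [measurable] = weak_grad_measurable[OF \<open>open \<Omega>\<close> wd]
  have [measurable]: "g \<in> borel_measurable (lebesgue_on \<Omega>)" using assms(4) unfolding Lp_def by simp
  have AE: "AE x in lebesgue_on \<Omega>. norm (weak_grad \<Omega> u x) powr p = norm (g x) powr p"
    using weak_grad_AE_eq[OF assms(1,3)] by eventually_elim simp
  have "integrable (lebesgue_on \<Omega>) (\<lambda>x. norm (weak_grad \<Omega> u x) powr p)
      \<longleftrightarrow> integrable (lebesgue_on \<Omega>) (\<lambda>x. norm (g x) powr p)"
    by (rule integrable_cong_AE[OF _ _ AE]) measurable
  then show ?thesis
    using assms(2,4) wd weak_grad_measurable[OF \<open>open \<Omega>\<close> wd] unfolding W1p_def Lp_def by simp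
qed

lemma W1p_weak_grad: "u \<in> W1p \<Omega> p \<Longrightarrow> has_weak_gradient \<Omega> u (weak_grad \<Omega> u)"
  unfolding W1p_def by (simp add: weakly_differentiable_weak_grad)

lemma weak_grad_scale_add:
  assumes "open \<Omega>" "u \<in> W1p \<Omega> p" "v \<in> W1p \<Omega> p"
  shows "AE x in lebesgue_on \<Omega>. weak_grad \<Omega> (\<lambda>x. a * u x + b * v x) x
    = a *\<^sub>R weak_grad \<Omega> u x + b *\<^sub>R weak_grad \<Omega> v x"
  using assms by (intro weak_grad_AE_eq has_weak_gradient_scale_add W1p_weak_grad)

lemma W1p_scale_add:
  assumes "open \<Omega>" "0 \<le> p" "u \<in> W1p \<Omega> p" "v \<in> W1p \<Omega> p"
  shows "(\<lambda>x. a * u x + b * v x) \<in> W1p \<Omega> p"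
proof (rule W1pI[OF \<open>open \<Omega>\<close>])
  show "(\<lambda>x. a * u x + b * v x) \<in> Lp \<Omega> p"
    using assms Lp_scale_add[of p u \<Omega> v a b] unfolding W1p_def by simp
  show "has_weak_gradient \<Omega> (\<lambda>x. a * u x + b * v x) (\<lambda>x. a *\<^sub>R weak_grad \<Omega> u x + b *\<^sub>R weak_grad \<Omega> v x)"
    using assms by (intro has_weak_gradient_scale_add W1p_weak_grad)
  show "(\<lambda>x. a *\<^sub>R weak_grad \<Omega> u x + b *\<^sub>R weak_grad \<Omega> v x) \<in> Lp \<Omega> p"
    using assms unfolding W1p_def by (intro Lp_scale_add) auto
qed

section \<open>Test functions as Sobolev functions\<close>

lemma finite_measure_bounded_open:
  assumes "open \<Omega>" "bounded \<Omega>"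
  shows "finite_measure (lebesgue_on (\<Omega> :: 'a::euclidean_space set))"
  using assms by (intro finite_measure_lebesgue_on bounded_set_imp_lmeasurable) auto

lemma bounded_continuous_Lp:
  fixes f :: "'a::euclidean_space \<Rightarrow> 'b::euclidean_space"
  assumes "open \<Omega>" "bounded \<Omega>" "0 \<le> p" "continuous_on UNIV f" "\<And>x. norm (f x) \<le> B"
  shows "f \<in> Lp \<Omega> p"
proof -
  interpret finite_measure "lebesgue_on \<Omega>" using assms(1,2) by (rule finite_measure_bounded_open)
  have [measurable]: "f \<in> borel_measurable (lebesgue_on \<Omega>)"
    using assms by (intro continuous_imp_measurable_on_sets_lebesgue) (auto intro: continuous_on_subset)
  have "integrable (lebesgue_on \<Omega>) (\<lambda>x. norm (f x) powr p)"
  proof (rule integrable_const_bound)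
    show "AE x in lebesgue_on \<Omega>. norm (norm (f x) powr p) \<le> B powr p"
      using assms(3,5) by (intro AE_I2) (auto intro: powr_mono2)
  qed measurable
  then show ?thesis unfolding Lp_def by simp
qed

lemma test_function_W1p:
  fixes \<Omega> :: "'a::euclidean_space set"
  assumes "open \<Omega>" "bounded \<Omega>" "0 \<le> p" and \<phi>: "\<phi> \<in> test_functions \<Omega>"
  shows "\<phi> \<in> W1p \<Omega> p"
proof -
  note cont = test_function_continuous[OF \<phi>] test_function_gradient_continuous[OF \<phi>]
  obtain K where K: "compact K" "\<And>x. x \<notin> K \<Longrightarrow> \<phi> x = 0" "\<And>x. x \<notin> K \<Longrightarrow> gradient \<phi> x = 0"
    using test_function_support[OF \<phi>] by metis
  obtain B where B: "\<And>x. norm (\<phi> x) \<le> B"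
    using continuous_compact_support_bounded[OF cont(1) K(1,2)] by metis
  obtain B' where B': "\<And>x. norm (gradient \<phi> x) \<le> B'"
    using continuous_compact_support_bounded[OF cont(2) K(1,3)] by metis
  show ?thesis
    using assms cont B B'
    by (intro W1pI[OF \<open>open \<Omega>\<close> _ has_weak_gradient_test_function] bounded_continuous_Lp) auto
qed

text \<open>The p-th power of \<open>W1p_norm\<close>. It is convex by integrating a pointwise
  inequality, and this takes the place of Minkowski's inequality.\<close>

definition W1p_energy :: "'a::euclidean_space set \<Rightarrow> real \<Rightarrow> ('a \<Rightarrow> real) \<Rightarrow> real" where
  "W1p_energy \<Omega> p u = (LINT x|lebesgue_on \<Omega>. norm (u x) powr p) +
     (LINT x|lebesgue_on \<Omega>. norm (weak_grad \<Omega> u x) powr p)"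

lemma W1p_energy_nonneg: "0 \<le> W1p_energy \<Omega> p u"
  unfolding W1p_energy_def by (intro add_nonneg_nonneg integral_nonneg) auto

lemma W1p_norm_energy: "W1p_norm \<Omega> p u = W1p_energy \<Omega> p u powr (1 / p)"
  unfolding W1p_norm_def W1p_energy_def ..

text \<open>The combination is required only almost everywhere, so that the estimate covers both the
  functions themselves and their chosen weak gradients.\<close>

lemma integral_norm_powr_convex_combination:
  assumes "1 \<le> p" "0 \<le> t" "t \<le> 1" "f \<in> Lp \<Omega> p" "g \<in> Lp \<Omega> p" "h \<in> Lp \<Omega> p"
    and h: "AE x in lebesgue_on \<Omega>. h x = (1 - t) *\<^sub>R f x + t *\<^sub>R g x"
  shows "(LINT x|lebesgue_on \<Omega>. norm (h x) powr p)
    \<le> (1 - t) * (LINT x|lebesgue_on \<Omega>. norm (f x) powr p) + t * (LINT x|lebesgue_on \<Omega>. norm (g x) powr p)"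
proof -
  have int: "integrable (lebesgue_on \<Omega>) (\<lambda>x. norm (f x) powr p)"
      "integrable (lebesgue_on \<Omega>) (\<lambda>x. norm (g x) powr p)"
      "integrable (lebesgue_on \<Omega>) (\<lambda>x. norm (h x) powr p)"
    using assms unfolding Lp_def by auto
  have "(LINT x|lebesgue_on \<Omega>. norm (h x) powr p)
      \<le> (LINT x|lebesgue_on \<Omega>. (1 - t) * norm (f x) powr p + t * norm (g x) powr p)"
  proof (rule integral_mono_AE)
    show "AE x in lebesgue_on \<Omega>. norm (h x) powr p \<le> (1 - t) * norm (f x) powr p + t * norm (g x) powr p"
      using h by eventually_elim (use norm_powr_convex_combination assms in auto)
  qed (use int in auto)
  then show ?thesis using int by simp
qed

lemma W1p_energy_convex_combination:
  assumes "open \<Omega>" "1 \<le> p" "0 \<le> t" "t \<le> 1" and u: "u \<in> W1p \<Omega> p" and v: "v \<in> W1p \<Omega> p"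
  shows "W1p_energy \<Omega> p (\<lambda>x. (1 - t) * u x + t * v x) \<le> (1 - t) * W1p_energy \<Omega> p u + t * W1p_energy \<Omega> p v"
proof -
  have w: "(\<lambda>x. (1 - t) * u x + t * v x) \<in> W1p \<Omega> p"
    using assms by (intro W1p_scale_add) auto
  have "(LINT x|lebesgue_on \<Omega>. norm ((1 - t) * u x + t * v x) powr p)
    \<le> (1 - t) * (LINT x|lebesgue_on \<Omega>. norm (u x) powr p) + t * (LINT x|lebesgue_on \<Omega>. norm (v x) powr p)"
    using u v w assms unfolding W1p_def by (intro integral_norm_powr_convex_combination) auto
  moreover have "(LINT x|lebesgue_on \<Omega>. norm (weak_grad \<Omega> (\<lambda>x. (1 - t) * u x + t * v x) x) powr p)
    \<le> (1 - t) * (LINT x|lebesgue_on \<Omega>. norm (weak_grad \<Omega> u x) powr p)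
      + t * (LINT x|lebesgue_on \<Omega>. norm (weak_grad \<Omega> v x) powr p)"
    using u v w assms weak_grad_scale_add[OF \<open>open \<Omega>\<close> u v] unfolding W1p_def
    by (intro integral_norm_powr_convex_combination) auto
  ultimately show ?thesis unfolding W1p_energy_def by (simp add: algebra_simps)
qed

text \<open>Combine the approximating test functions with the same weights. By convexity the energy
  of the combined error is at most the larger of the two energies, so its norm stays below the same
  \<epsilon>, without a triangle inequality.\<close>

lemma W1p_0_convex_combination:
  assumes \<Omega>: "open \<Omega>" "bounded \<Omega>" and "1 \<le> p" "0 \<le> t" "t \<le> 1"
    and u: "u \<in> W1p_0 \<Omega> p" and v: "v \<in> W1p_0 \<Omega> p"
  shows "(\<lambda>x. (1 - t) * u x + t * v x) \<in> W1p_0 \<Omega> p"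
proof -
  have uv: "u \<in> W1p \<Omega> p" "v \<in> W1p \<Omega> p" using u v unfolding W1p_0_def by auto
  have "\<exists>\<phi>\<in>test_functions \<Omega>. W1p_norm \<Omega> p (\<lambda>x. (1 - t) * u x + t * v x - \<phi> x) < \<epsilon>" if "\<epsilon> > 0" for \<epsilon>
  proof -
    obtain \<phi> \<eta> where \<phi>: "\<phi> \<in> test_functions \<Omega>" "W1p_norm \<Omega> p (\<lambda>x. u x - \<phi> x) < \<epsilon>"
      and \<eta>: "\<eta> \<in> test_functions \<Omega>" "W1p_norm \<Omega> p (\<lambda>x. v x - \<eta> x) < \<epsilon>"
      using u v \<open>\<epsilon> > 0\<close> unfolding W1p_0_def by blast
    have p: "0 \<le> p" using \<open>1 \<le> p\<close> by simp
    let ?a = "\<lambda>x. 1 * u x + (- 1) * \<phi> x" and ?b = "\<lambda>x. 1 * v x + (- 1) * \<eta> x"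
    have ab: "?a \<in> W1p \<Omega> p" "?b \<in> W1p \<Omega> p"
      by (rule W1p_scale_add[OF \<Omega>(1) p uv(1) test_function_W1p[OF \<Omega> p \<phi>(1)]],
          rule W1p_scale_add[OF \<Omega>(1) p uv(2) test_function_W1p[OF \<Omega> p \<eta>(1)]])
    let ?m = "max (W1p_energy \<Omega> p ?a) (W1p_energy \<Omega> p ?b)"
    have "W1p_energy \<Omega> p (\<lambda>x. (1 - t) * ?a x + t * ?b x)
        \<le> (1 - t) * W1p_energy \<Omega> p ?a + t * W1p_energy \<Omega> p ?b"
      using assms ab by (intro W1p_energy_convex_combination)
    also have "\<dots> \<le> (1 - t) * ?m + t * ?m"
      using assms by (intro add_mono mult_left_mono) auto
    finally have "W1p_energy \<Omega> p (\<lambda>x. (1 - t) * ?a x + t * ?b x) \<le> ?m"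
      by (simp add: algebra_simps)
    then have "W1p_norm \<Omega> p (\<lambda>x. (1 - t) * ?a x + t * ?b x) \<le> ?m powr (1 / p)"
      unfolding W1p_norm_energy using assms W1p_energy_nonneg by (intro powr_mono2) auto
    also have "?m powr (1 / p) < \<epsilon>"
      using \<phi>(2) \<eta>(2) unfolding W1p_norm_energy by (auto simp: max_def)
    also have "(\<lambda>x. (1 - t) * ?a x + t * ?b x)
        = (\<lambda>x. (1 - t) * u x + t * v x - ((1 - t) * \<phi> x + t * \<eta> x))"
      by (auto simp: algebra_simps)
    finally show ?thesis
      using test_functions_scale_add[OF \<phi>(1) \<eta>(1), of "1 - t" t]
      by (rule bexI[of _ "\<lambda>x. (1 - t) * \<phi> x + t * \<eta> x"])
  qed
  moreover have "(\<lambda>x. (1 - t) * u x + t * v x) \<in> W1p \<Omega> p"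
    using assms uv by (intro W1p_scale_add) auto
  ultimately show ?thesis unfolding W1p_0_def by simp
qed

text \<open>If \<eta> approximates u, then \<eta> + \<phi> approximates u + \<phi> with literally
  the same error function.\<close>

lemma W1p_0_add_test_function:
  assumes \<Omega>: "open \<Omega>" "bounded \<Omega>" and "0 \<le> p" and u: "u \<in> W1p_0 \<Omega> p" and \<phi>: "\<phi> \<in> test_functions \<Omega>"
  shows "(\<lambda>x. u x + \<phi> x) \<in> W1p_0 \<Omega> p"
proof -
  have "\<exists>\<eta>\<in>test_functions \<Omega>. W1p_norm \<Omega> p (\<lambda>x. u x + \<phi> x - \<eta> x) < \<epsilon>" if "\<epsilon> > 0" for \<epsilon>
  proof -
    obtain \<eta> where \<eta>: "\<eta> \<in> test_functions \<Omega>" "W1p_norm \<Omega> p (\<lambda>x. u x - \<eta> x) < \<epsilon>"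
      using u \<open>\<epsilon> > 0\<close> unfolding W1p_0_def by blast
    then show ?thesis
      using test_functions_scale_add[OF \<eta>(1) \<phi>, of 1 1]
      by (intro bexI[of _ "\<lambda>x. 1 * \<eta> x + 1 * \<phi> x"]) (auto simp: algebra_simps)
  qed
  moreover have "(\<lambda>x. u x + \<phi> x) \<in> W1p \<Omega> p"
    using W1p_scale_add[of \<Omega> p u \<phi> 1 1] assms test_function_W1p[OF \<Omega> \<open>0 \<le> p\<close> \<phi>]
    unfolding W1p_0_def by simp
  ultimately show ?thesis unfolding W1p_0_def by simp
qed

section \<open>The variational inequality\<close>

text \<open>Weight the supporting inequalities at the intermediate point m by 1 - t and t; the
  linear terms cancel.\<close>

lemma convex_combination_le:
  fixes F :: "'a::real_inner \<Rightarrow> real"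
  assumes supp: "\<And>\<xi> \<eta>. F \<eta> + F' \<eta> \<bullet> (\<xi> - \<eta>) \<le> F \<xi>" and "0 \<le> t" "t \<le> 1"
  shows "F ((1 - t) *\<^sub>R \<xi> + t *\<^sub>R \<zeta>) \<le> (1 - t) * F \<xi> + t * F \<zeta>"
proof -
  define m where "m = (1 - t) *\<^sub>R \<xi> + t *\<^sub>R \<zeta>"
  have "(1 - t) * (F m + F' m \<bullet> (\<xi> - m)) + t * (F m + F' m \<bullet> (\<zeta> - m)) \<le> (1 - t) * F \<xi> + t * F \<zeta>"
    using assms by (intro add_mono mult_left_mono supp) auto
  moreover have "(1 - t) * (F' m \<bullet> (\<xi> - m)) + t * (F' m \<bullet> (\<zeta> - m)) = F' m \<bullet> ((1 - t) *\<^sub>R \<xi> + t *\<^sub>R \<zeta> - m)"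
    by (simp add: inner_diff_right inner_add_right algebra_simps)
  moreover have "\<dots> = 0" by (simp add: m_def)
  ultimately show ?thesis unfolding m_def[symmetric] by (simp add: algebra_simps)
qed

text \<open>The supporting hyperplane inequality says exactly that the supremum is attained at
  \<eta>. In particular the polar is finite there.\<close>

lemma polar_at_subgradient:
  assumes "\<And>\<xi>. F \<eta> + \<zeta> \<bullet> (\<xi> - \<eta>) \<le> F \<xi>"
  shows "polar F \<zeta> = ereal (\<zeta> \<bullet> \<eta> - F \<eta>)"
  unfolding polar_def
proof (rule antisym)
  show "(SUP \<xi>. ereal (\<zeta> \<bullet> \<xi> - F \<xi>)) \<le> ereal (\<zeta> \<bullet> \<eta> - F \<eta>)"
  proof (rule SUP_least)
    show "ereal (\<zeta> \<bullet> \<xi> - F \<xi>) \<le> ereal (\<zeta> \<bullet> \<eta> - F \<eta>)" for \<xi>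
      using assms[of \<xi>] by (simp add: inner_diff_right)
  qed
  show "ereal (\<zeta> \<bullet> \<eta> - F \<eta>) \<le> (SUP \<xi>. ereal (\<zeta> \<bullet> \<xi> - F \<xi>))"
    by (rule SUP_upper) simp
qed

text \<open>The test point 2 \<eta> gives the upper bound C F(\<eta>), the test point 0 the lower
  bound -F(0). Both may be added because C F(\<eta>) \<ge> F(2 \<eta>) \<ge> 0, whatever the sign of
  C.\<close>

lemma subgradient_inner_self_bound:
  fixes F :: "'a::real_inner \<Rightarrow> real"
  assumes supp: "\<And>\<xi> \<eta>. F \<eta> + F' \<eta> \<bullet> (\<xi> - \<eta>) \<le> F \<xi>"
    and nonneg: "\<And>\<xi>. 0 \<le> F \<xi>" and C: "\<And>\<xi>. F (2 *\<^sub>R \<xi>) \<le> C * F \<xi>"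
  shows "\<bar>F' \<eta> \<bullet> \<eta>\<bar> \<le> C * F \<eta> + F 0"
  using supp[of \<eta> 0] supp[of \<eta> "2 *\<^sub>R \<eta>"] C[of \<eta>] nonneg[of \<eta>] nonneg[of 0] nonneg[of "2 *\<^sub>R \<eta>"]
  by (simp add: inner_diff_right)

text \<open>F need not be even, so the lower bound costs F(-\<xi>). This is the origin of the
  integrability condition on F(-Dz).\<close>

lemma subgradient_inner_bound:
  fixes F :: "'a::real_inner \<Rightarrow> real"
  assumes supp: "\<And>\<xi> \<eta>. F \<eta> + F' \<eta> \<bullet> (\<xi> - \<eta>) \<le> F \<xi>" and nonneg: "\<And>\<xi>. 0 \<le> F \<xi>"
  shows "\<bar>F' \<eta> \<bullet> \<xi>\<bar> \<le> F \<xi> + F (- \<xi>) + \<bar>F' \<eta> \<bullet> \<eta>\<bar>"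
  using supp[of \<eta> \<xi>] supp[of \<eta> "- \<xi>"] nonneg[of \<eta>] nonneg[of \<xi>] nonneg[of "- \<xi>"]
  by (simp add: inner_diff_right)

text \<open>Stated for measurable fields with minimality along one segment, so that no Sobolev
  structure appears. The upper bound F(h) - F(g) of the quotients is integrable by the first two
  integrability hypotheses; the lower bound F'(g) \<bullet> (h - g) has to be assumed
  integrable.\<close>

lemma first_variation_nonneg:
  fixes F :: "'a::euclidean_space \<Rightarrow> real" and F' :: "'a \<Rightarrow> 'a"
  assumes deriv: "\<And>\<xi>. GDERIV F \<xi> :> F' \<xi>"
    and supp: "\<And>\<xi> \<eta>. F \<eta> + F' \<eta> \<bullet> (\<xi> - \<eta>) \<le> F \<xi>"
    and [measurable]: "F \<in> borel_measurable borel" "g \<in> borel_measurable M" "h \<in> borel_measurable M"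
    and int: "integrable M (\<lambda>x. F (g x))" "integrable M (\<lambda>x. F (h x))"
      "integrable M (\<lambda>x. F' (g x) \<bullet> (h x - g x))"
    and min: "\<And>t. 0 < t \<Longrightarrow> t \<le> 1 \<Longrightarrow>
      integrable M (\<lambda>x. F ((1 - t) *\<^sub>R g x + t *\<^sub>R h x)) \<and>
      (LINT x|M. F (g x)) \<le> (LINT x|M. F ((1 - t) *\<^sub>R g x + t *\<^sub>R h x))"
  shows "0 \<le> (LINT x|M. F' (g x) \<bullet> (h x - g x))"
proof -
  \<comment> \<open>\<open>Suc\<close> keeps \<open>t n\<close> in the interval (0, 1], so
    minimality is available from the first term on.\<close>
  define t where "t n = 1 / real (Suc n)" for n
  have t: "0 < t n" "t n \<le> 1" for n by (auto simp: t_def)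
  define s where "s n x = real (Suc n) * (F (g x + t n *\<^sub>R (h x - g x)) - F (g x))" for n x
  have comb: "g x + t n *\<^sub>R (h x - g x) = (1 - t n) *\<^sub>R g x + t n *\<^sub>R h x" for n x
    by (simp add: algebra_simps)
  have "(\<lambda>n. LINT x|M. s n x) \<longlonglongrightarrow> (LINT x|M. F' (g x) \<bullet> (h x - g x))"
  proof (rule integral_dominated_convergence
      [where w="\<lambda>x. \<bar>F' (g x) \<bullet> (h x - g x)\<bar> + \<bar>F (h x) - F (g x)\<bar>"])
    show "(\<lambda>x. F' (g x) \<bullet> (h x - g x)) \<in> borel_measurable M"
      using int(3) by (rule borel_measurable_integrable)
    show "s n \<in> borel_measurable M" for n unfolding s_def by measurable
    show "integrable M (\<lambda>x. \<bar>F' (g x) \<bullet> (h x - g x)\<bar> + \<bar>F (h x) - F (g x)\<bar>)"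
      using int by auto
    show "AE x in M. (\<lambda>n. s n x) \<longlonglongrightarrow> F' (g x) \<bullet> (h x - g x)"
      unfolding s_def t_def using GDERIV_directional_sequence[OF deriv] by (intro AE_I2)
    have "\<bar>s n x\<bar> \<le> \<bar>F' (g x) \<bullet> (h x - g x)\<bar> + \<bar>F (h x) - F (g x)\<bar>" for n x
    proof -
      have "t n * (F' (g x) \<bullet> (h x - g x)) \<le> F (g x + t n *\<^sub>R (h x - g x)) - F (g x)"
        using supp[of "g x" "g x + t n *\<^sub>R (h x - g x)"] by simp
      then have lower: "F' (g x) \<bullet> (h x - g x) \<le> s n x"
        by (simp add: s_def t_def field_simps)
      have "F (g x + t n *\<^sub>R (h x - g x)) - F (g x) \<le> t n * (F (h x) - F (g x))"
        using convex_combination_le[of F F' "t n" "g x" "h x", OF supp] t[of n]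
        unfolding comb by (simp add: algebra_simps)
      then have "s n x \<le> F (h x) - F (g x)"
        by (simp add: s_def t_def field_simps)
      with lower show ?thesis by linarith
    qed
    then show "AE x in M. norm (s n x) \<le> \<bar>F' (g x) \<bullet> (h x - g x)\<bar> + \<bar>F (h x) - F (g x)\<bar>" for n
      by (intro AE_I2) simp
  qed
  moreover have "0 \<le> (LINT x|M. s n x)" for n
  proof -
    have "(LINT x|M. s n x)
        = real (Suc n) * ((LINT x|M. F ((1 - t n) *\<^sub>R g x + t n *\<^sub>R h x)) - (LINT x|M. F (g x)))"
      unfolding s_def comb using min[OF t] int(1) by (simp del: of_nat_Suc)
    with min[OF t, of n] show ?thesis by (simp del: of_nat_Suc)
  qed
  ultimately show ?thesis by (intro LIMSEQ_le_const) auto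
qed

section \<open>Admissible competitors\<close>

lemma admissible_W1p:
  assumes "open \<Omega>" "0 \<le> p" "u\<^sub>0 \<in> W1p \<Omega> p" "z \<in> admissible \<Omega> p F \<psi> u\<^sub>0"
  shows "z \<in> W1p \<Omega> p"
proof -
  have "(\<lambda>x. z x - u\<^sub>0 x) \<in> W1p \<Omega> p"
    using assms(4) unfolding admissible_def W1p_0_def by auto
  from W1p_scale_add[OF assms(1,2) this assms(3), of 1 1] show ?thesis by simp
qed

lemma W1p_weak_grad_measurable:
  "open \<Omega> \<Longrightarrow> u \<in> W1p \<Omega> p \<Longrightarrow> weak_grad \<Omega> u \<in> borel_measurable (lebesgue_on \<Omega>)"
  unfolding W1p_def by (simp add: weak_grad_measurable)

lemma admissible_convex_combination:
  fixes F :: "'a::euclidean_space \<Rightarrow> real"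
  assumes \<Omega>: "open \<Omega>" "bounded \<Omega>" and "1 \<le> p" and t: "0 \<le> t" "t \<le> 1" and u\<^sub>0: "u\<^sub>0 \<in> W1p \<Omega> p"
    and F: "F \<in> borel_measurable borel" "\<And>\<xi>. 0 \<le> F \<xi>"
      "\<And>\<xi> \<eta>. F ((1 - t) *\<^sub>R \<xi> + t *\<^sub>R \<eta>) \<le> (1 - t) * F \<xi> + t * F \<eta>"
    and u: "u \<in> admissible \<Omega> p F \<psi> u\<^sub>0" and z: "z \<in> admissible \<Omega> p F \<psi> u\<^sub>0"
  shows "(\<lambda>x. (1 - t) * u x + t * z x) \<in> admissible \<Omega> p F \<psi> u\<^sub>0" (is "?w \<in> _")
proof -
  note [measurable] = F(1)
  have W: "u \<in> W1p \<Omega> p" "z \<in> W1p \<Omega> p" and "?w \<in> W1p \<Omega> p"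
    using admissible_W1p[OF \<Omega>(1) _ u\<^sub>0] u z \<open>1 \<le> p\<close> by (auto intro!: W1p_scale_add \<Omega>)
  note [measurable] = this[THEN W1p_weak_grad_measurable[OF \<Omega>(1)]]
  have "(\<lambda>x. (1 - t) * (u x - u\<^sub>0 x) + t * (z x - u\<^sub>0 x)) \<in> W1p_0 \<Omega> p"
    using u z unfolding admissible_def by (intro W1p_0_convex_combination assms) auto
  also have "(\<lambda>x. (1 - t) * (u x - u\<^sub>0 x) + t * (z x - u\<^sub>0 x)) = (\<lambda>x. ?w x - u\<^sub>0 x)"
    by (auto simp: algebra_simps)
  finally have bdry: "(\<lambda>x. ?w x - u\<^sub>0 x) \<in> W1p_0 \<Omega> p" .
  have "AE x in lebesgue_on \<Omega>. \<psi> x \<le> ereal (u x)" "AE x in lebesgue_on \<Omega>. \<psi> x \<le> ereal (z x)"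
    using u z unfolding admissible_def by auto
  then have obst: "AE x in lebesgue_on \<Omega>. \<psi> x \<le> ereal (?w x)"
  proof eventually_elim
    case (elim x)
    \<comment> \<open>Comparing through the real number min(u, z) avoids arithmetic with the
      extended real \<psi>.\<close>
    have "(1 - t) * min (u x) (z x) + t * min (u x) (z x) \<le> ?w x"
      using t by (intro add_mono mult_left_mono) auto
    then have "min (u x) (z x) \<le> ?w x" by (simp add: algebra_simps)
    moreover have "\<psi> x \<le> ereal (min (u x) (z x))" using elim by (simp add: min_def)
    ultimately show ?case by (meson ereal_less_eq(3) order_trans)
  qed
  have int: "integrable (lebesgue_on \<Omega>) (\<lambda>x. F (weak_grad \<Omega> u x))"
    "integrable (lebesgue_on \<Omega>) (\<lambda>x. F (weak_grad \<Omega> z x))"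
    using u z unfolding admissible_def by auto
  have "integrable (lebesgue_on \<Omega>) (\<lambda>x. F (weak_grad \<Omega> ?w x))"
  proof (rule Bochner_Integration.integrable_bound)
    show "integrable (lebesgue_on \<Omega>) (\<lambda>x. (1 - t) * F (weak_grad \<Omega> u x) + t * F (weak_grad \<Omega> z x))"
      using int by simp
    show "AE x in lebesgue_on \<Omega>. norm (F (weak_grad \<Omega> ?w x))
        \<le> norm ((1 - t) * F (weak_grad \<Omega> u x) + t * F (weak_grad \<Omega> z x))"
      using weak_grad_scale_add[OF \<Omega>(1) W, of "1 - t" t]
    proof eventually_elim
      case (elim x)
      then show ?case using F(3)[of "weak_grad \<Omega> u x" "weak_grad \<Omega> z x"] F(2)[of "weak_grad \<Omega> ?w x"] by simp
    qed
  qed measurable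
  with bdry obst show ?thesis unfolding admissible_def by simp
qed

text \<open>F is bounded on the closed ball of radius B, and the bounded set \<Omega> has finite
  measure.\<close>

lemma bounded_field_integrable:
  fixes F :: "'a::euclidean_space \<Rightarrow> real" and f :: "'b::euclidean_space \<Rightarrow> 'a"
  assumes "open \<Omega>" "bounded \<Omega>" "continuous_on UNIV F" "continuous_on UNIV f" "\<And>x. norm (f x) \<le> B"
  shows "integrable (lebesgue_on \<Omega>) (\<lambda>x. F (f x))"
proof -
  interpret finite_measure "lebesgue_on \<Omega>" using assms(1,2) by (rule finite_measure_bounded_open)
  have "compact (F ` cball 0 B)"
    using assms(3) by (intro compact_continuous_image) (auto intro: continuous_on_subset)
  then obtain C where C: "\<And>\<xi>. \<xi> \<in> cball 0 B \<Longrightarrow> norm (F \<xi>) \<le> C"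
    by (metis compact_imp_bounded bounded_iff image_eqI)
  have [measurable]: "f \<in> borel_measurable (lebesgue_on \<Omega>)" "F \<in> borel_measurable borel"
    using assms by (auto intro!: continuous_imp_measurable_on_sets_lebesgue borel_measurable_continuous_onI
        intro: continuous_on_subset)
  show ?thesis
  proof (rule integrable_const_bound)
    show "AE x in lebesgue_on \<Omega>. norm (F (f x)) \<le> C"
      using C assms(5) by (intro AE_I2) simp
  qed measurable
qed

lemma admissible_add_test_function:
  fixes F :: "'a::euclidean_space \<Rightarrow> real"
  assumes \<Omega>: "open \<Omega>" "bounded \<Omega>" and "0 \<le> p" and u\<^sub>0: "u\<^sub>0 \<in> W1p \<Omega> p"
    and F: "continuous_on UNIV F" "\<And>\<xi>. 0 \<le> F \<xi>"
      "\<And>\<xi> \<eta>. F ((1/2) *\<^sub>R \<xi> + (1/2) *\<^sub>R \<eta>) \<le> (1/2) * F \<xi> + (1/2) * F \<eta>"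
      "\<And>\<xi>. F (2 *\<^sub>R \<xi>) \<le> C * F \<xi>"
    and u: "u \<in> admissible \<Omega> p F \<psi> u\<^sub>0" and \<phi>: "\<phi> \<in> test_functions \<Omega>" "\<And>x. 0 \<le> \<phi> x"
  shows "(\<lambda>x. u x + \<phi> x) \<in> admissible \<Omega> p F \<psi> u\<^sub>0"
    and "AE x in lebesgue_on \<Omega>. weak_grad \<Omega> (\<lambda>x. u x + \<phi> x) x = weak_grad \<Omega> u x + gradient \<phi> x"
proof -
  have [measurable]: "F \<in> borel_measurable borel" using F(1) by (rule borel_measurable_continuous_onI)
  have W: "u \<in> W1p \<Omega> p" using admissible_W1p[OF \<Omega>(1) \<open>0 \<le> p\<close> u\<^sub>0 u] .
  have W': "(\<lambda>x. u x + \<phi> x) \<in> W1p \<Omega> p"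
    using W1p_scale_add[OF \<Omega>(1) \<open>0 \<le> p\<close> W test_function_W1p[OF \<Omega> \<open>0 \<le> p\<close> \<phi>(1)], of 1 1] by simp
  note [measurable] = W[THEN W1p_weak_grad_measurable[OF \<Omega>(1)]] W'[THEN W1p_weak_grad_measurable[OF \<Omega>(1)]]
  have "has_weak_gradient \<Omega> (\<lambda>x. 1 * u x + 1 * \<phi> x) (\<lambda>x. 1 *\<^sub>R weak_grad \<Omega> u x + 1 *\<^sub>R gradient \<phi> x)"
    by (intro has_weak_gradient_scale_add W1p_weak_grad[OF W] has_weak_gradient_test_function \<Omega> \<phi>)
  from weak_grad_AE_eq[OF \<Omega>(1) this]
  show grad: "AE x in lebesgue_on \<Omega>. weak_grad \<Omega> (\<lambda>x. u x + \<phi> x) x = weak_grad \<Omega> u x + gradient \<phi> x"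
    by simp
  have "(\<lambda>x. (u x - u\<^sub>0 x) + \<phi> x) \<in> W1p_0 \<Omega> p"
    using u \<phi>(1) unfolding admissible_def by (intro W1p_0_add_test_function \<Omega> \<open>0 \<le> p\<close>) auto
  then have bdry: "(\<lambda>x. u x + \<phi> x - u\<^sub>0 x) \<in> W1p_0 \<Omega> p" by (simp add: algebra_simps)
  have "AE x in lebesgue_on \<Omega>. \<psi> x \<le> ereal (u x)" using u unfolding admissible_def by auto
  then have obst: "AE x in lebesgue_on \<Omega>. \<psi> x \<le> ereal (u x + \<phi> x)"
  proof eventually_elim
    case (elim x)
    then show ?case using \<phi>(2)[of x] by (meson ereal_less_eq(3) le_add_same_cancel1 order_trans)
  qed
  obtain K where K: "compact K" "\<And>x. x \<notin> K \<Longrightarrow> gradient \<phi> x = 0"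
    using test_function_support[OF \<phi>(1)] by metis
  note cont = test_function_gradient_continuous[OF \<phi>(1)]
  obtain B where B: "\<And>x. norm (gradient \<phi> x) \<le> B"
    using continuous_compact_support_bounded[OF cont K] by metis
  have int: "integrable (lebesgue_on \<Omega>) (\<lambda>x. F (weak_grad \<Omega> u x))"
    using u unfolding admissible_def by auto
  have int': "integrable (lebesgue_on \<Omega>) (\<lambda>x. F (2 *\<^sub>R gradient \<phi> x))"
    by (rule bounded_field_integrable[OF \<Omega> F(1), where B="2 * B"])
       (use B in \<open>auto intro!: continuous_intros cont\<close>)
  have "integrable (lebesgue_on \<Omega>) (\<lambda>x. F (weak_grad \<Omega> (\<lambda>x. u x + \<phi> x) x))"
  proof (rule Bochner_Integration.integrable_bound)
    show "integrable (lebesgue_on \<Omega>) (\<lambda>x. (1/2) * (C * F (weak_grad \<Omega> u x)) + (1/2) * F (2 *\<^sub>R gradient \<phi> x))"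
      using int int' by (intro Bochner_Integration.integrable_add integrable_mult_right)
    show "AE x in lebesgue_on \<Omega>. norm (F (weak_grad \<Omega> (\<lambda>x. u x + \<phi> x) x))
        \<le> norm ((1/2) * (C * F (weak_grad \<Omega> u x)) + (1/2) * F (2 *\<^sub>R gradient \<phi> x))"
      using grad
    proof eventually_elim
      case (elim x)
      \<comment> \<open>Du + D\<phi> is the midpoint of 2 Du and 2 D\<phi>; doubling then brings 2
        Du back to Du.\<close>
      have "F (weak_grad \<Omega> u x + gradient \<phi> x) \<le> (1/2) * F (2 *\<^sub>R weak_grad \<Omega> u x) + (1/2) * F (2 *\<^sub>R gradient \<phi> x)"
        using F(3)[of "2 *\<^sub>R weak_grad \<Omega> u x" "2 *\<^sub>R gradient \<phi> x"] by simp
      then show ?case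
        using elim F(4)[of "weak_grad \<Omega> u x"] F(2)[of "weak_grad \<Omega> u x + gradient \<phi> x"] by simp
    qed
  qed measurable
  with bdry obst show "(\<lambda>x. u x + \<phi> x) \<in> admissible \<Omega> p F \<psi> u\<^sub>0" unfolding admissible_def by simp
qed

text \<open>Integrability of the pairing stays a hypothesis because its two uses verify it
  differently: for u + \<phi> from boundedness of D\<phi>, for a general z from F(Dz) and
  F(-Dz).\<close>

lemma minimizer_variational_inequality:
  fixes F :: "'a::euclidean_space \<Rightarrow> real" and F' :: "'a \<Rightarrow> 'a"
  assumes \<Omega>: "open \<Omega>" "bounded \<Omega>" and "1 \<le> p" and u\<^sub>0: "u\<^sub>0 \<in> W1p \<Omega> p"
    and deriv: "\<And>\<xi>. GDERIV F \<xi> :> F' \<xi>" and nonneg: "\<And>\<xi>. 0 \<le> F \<xi>"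
    and supp: "\<And>\<xi> \<eta>. F \<eta> + F' \<eta> \<bullet> (\<xi> - \<eta>) \<le> F \<xi>"
    and minimizer: "is_arg_min (\<lambda>z. LINT x|lebesgue_on \<Omega>. F (weak_grad \<Omega> z x))
                      (\<lambda>z. z \<in> admissible \<Omega> p F \<psi> u\<^sub>0) u"
    and z: "z \<in> admissible \<Omega> p F \<psi> u\<^sub>0"
    and int: "integrable (lebesgue_on \<Omega>) (\<lambda>x. F' (weak_grad \<Omega> u x) \<bullet> (weak_grad \<Omega> z x - weak_grad \<Omega> u x))"
  shows "0 \<le> (LINT x|lebesgue_on \<Omega>. F' (weak_grad \<Omega> u x) \<bullet> (weak_grad \<Omega> z x - weak_grad \<Omega> u x))"
proof -
  have "0 \<le> p" using \<open>1 \<le> p\<close> by simp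
  have u: "u \<in> admissible \<Omega> p F \<psi> u\<^sub>0" using minimizer unfolding is_arg_min_def by simp
  have W: "u \<in> W1p \<Omega> p" "z \<in> W1p \<Omega> p"
    using u z by (auto intro!: admissible_W1p[OF \<Omega>(1) \<open>0 \<le> p\<close> u\<^sub>0])
  have "isCont F \<xi>" for \<xi> using deriv[of \<xi>] unfolding gderiv_def by (rule has_derivative_continuous)
  then have F_meas[measurable]: "F \<in> borel_measurable borel"
    by (intro borel_measurable_continuous_onI) (simp add: continuous_at_imp_continuous_on)
  note meas[measurable] = W[THEN W1p_weak_grad_measurable[OF \<Omega>(1)]]
  show ?thesis
  proof (rule first_variation_nonneg[OF deriv supp F_meas meas _ _ int])
    show "integrable (lebesgue_on \<Omega>) (\<lambda>x. F (weak_grad \<Omega> u x))"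
      "integrable (lebesgue_on \<Omega>) (\<lambda>x. F (weak_grad \<Omega> z x))"
      using u z unfolding admissible_def by auto
    fix t :: real assume t: "0 < t" "t \<le> 1"
    let ?w = "\<lambda>x. (1 - t) * u x + t * z x"
    have w: "?w \<in> admissible \<Omega> p F \<psi> u\<^sub>0"
      using t by (intro admissible_convex_combination[OF \<Omega> \<open>1 \<le> p\<close> _ _ u\<^sub>0 F_meas nonneg _ u z]
          convex_combination_le[of F F'] supp) auto
    have [measurable]: "weak_grad \<Omega> ?w \<in> borel_measurable (lebesgue_on \<Omega>)"
      using W1p_weak_grad_measurable[OF \<Omega>(1) admissible_W1p[OF \<Omega>(1) \<open>0 \<le> p\<close> u\<^sub>0 w]] .
    have int_w: "integrable (lebesgue_on \<Omega>) (\<lambda>x. F (weak_grad \<Omega> ?w x))"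
      using w unfolding admissible_def by simp
    \<comment> \<open>Minimality speaks of the chosen weak gradient of the combination, the first
      variation of the combination of weak gradients; they agree only almost everywhere.\<close>
    have AE: "AE x in lebesgue_on \<Omega>. F (weak_grad \<Omega> ?w x)
        = F ((1 - t) *\<^sub>R weak_grad \<Omega> u x + t *\<^sub>R weak_grad \<Omega> z x)"
      using weak_grad_scale_add[OF \<Omega>(1) W, of "1 - t" t] by eventually_elim simp
    have "integrable (lebesgue_on \<Omega>) (\<lambda>x. F ((1 - t) *\<^sub>R weak_grad \<Omega> u x + t *\<^sub>R weak_grad \<Omega> z x))"
      by (rule integrable_cong_AE_imp[OF int_w]) (measurable, use AE in eventually_elim, simp)
    moreover have "(LINT x|lebesgue_on \<Omega>. F (weak_grad \<Omega> ?w x))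
        = (LINT x|lebesgue_on \<Omega>. F ((1 - t) *\<^sub>R weak_grad \<Omega> u x + t *\<^sub>R weak_grad \<Omega> z x))"
      by (rule integral_cong_AE[OF _ _ AE]) measurable
    moreover have "(LINT x|lebesgue_on \<Omega>. F (weak_grad \<Omega> u x)) \<le> (LINT x|lebesgue_on \<Omega>. F (weak_grad \<Omega> ?w x))"
      using minimizer w unfolding is_arg_min_def by (simp add: not_less)
    ultimately show "integrable (lebesgue_on \<Omega>) (\<lambda>x. F ((1 - t) *\<^sub>R weak_grad \<Omega> u x + t *\<^sub>R weak_grad \<Omega> z x)) \<and>
      (LINT x|lebesgue_on \<Omega>. F (weak_grad \<Omega> u x))
        \<le> (LINT x|lebesgue_on \<Omega>. F ((1 - t) *\<^sub>R weak_grad \<Omega> u x + t *\<^sub>R weak_grad \<Omega> z x))"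
      by simp
  qed
qed

theorem theorem1p2:
  fixes \<Omega> :: "(real ^ 'n) set"
    and F :: "real ^ 'n \<Rightarrow> real"
    and F' :: "real ^ 'n \<Rightarrow> real ^ 'n"
    and \<psi> :: "real ^ 'n \<Rightarrow> ereal"
    and u\<^sub>0 u :: "real ^ 'n \<Rightarrow> real"
    and \<l> L \<nu> p q :: real
  assumes dim: "CARD('n) \<ge> 2"
    and \<Omega>: "open \<Omega>" "bounded \<Omega>"
    and obstacle: "\<forall>x\<in>\<Omega>. \<psi> x < \<infinity>" "ereal_weakly_differentiable \<Omega> \<psi>"
    and boundary: "u\<^sub>0 \<in> W1p \<Omega> p"
    and nonempty: "admissible \<Omega> p F \<psi> u\<^sub>0 \<noteq> {}"
    and F_C1: "\<forall>\<xi>. GDERIV F \<xi> :> F' \<xi>" "continuous_on UNIV F'"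
    and constants: "0 < \<l>" "\<l> < L" "0 < \<nu>"
    and exponents: "1 < p" "p \<le> q"
    and growth: "\<forall>\<xi>. \<l> * norm \<xi> powr p \<le> F \<xi> \<and> F \<xi> \<le> L * (1 + norm \<xi> powr q)"
    and convexity: "\<forall>\<xi> \<eta>. \<nu> * (norm (V p \<xi> - V p \<eta>))\<^sup>2 \<le> F \<xi> - F \<eta> - F' \<eta> \<bullet> (\<xi> - \<eta>)"
    and doubling: "\<forall>r>1. \<exists>C. \<forall>\<xi>. F (r *\<^sub>R \<xi>) \<le> C * F \<xi>"
    and F_obstacle: "integrable (lebesgue_on \<Omega>) (\<lambda>x. F (ereal_weak_grad \<Omega> \<psi> x))"
    and F_boundary: "integrable (lebesgue_on \<Omega>) (\<lambda>x. F (weak_grad \<Omega> u\<^sub>0 x))"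
    and minimizer: "is_arg_min (\<lambda>z. LINT x|lebesgue_on \<Omega>. F (weak_grad \<Omega> z x))
                      (\<lambda>z. z \<in> admissible \<Omega> p F \<psi> u\<^sub>0) u"
  shows "ereal_integrable_on \<Omega> (\<lambda>x. polar F (F' (weak_grad \<Omega> u x)))
    \<and> integrable (lebesgue_on \<Omega>) (\<lambda>x. F' (weak_grad \<Omega> u x) \<bullet> weak_grad \<Omega> u x)
    \<and> distributional_div_nonpos \<Omega> (\<lambda>x. F' (weak_grad \<Omega> u x))
    \<and> (\<forall>z\<in>admissible \<Omega> p F \<psi> u\<^sub>0.
          integrable (lebesgue_on \<Omega>) (\<lambda>x. F (weak_grad \<Omega> z x)) \<and>
          integrable (lebesgue_on \<Omega>) (\<lambda>x. F (- weak_grad \<Omega> z x)) \<longrightarrow>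
          integrable (lebesgue_on \<Omega>)
            (\<lambda>x. F' (weak_grad \<Omega> u x) \<bullet> (weak_grad \<Omega> z x - weak_grad \<Omega> u x)) \<and>
          0 \<le> (LINT x|lebesgue_on \<Omega>.
                 F' (weak_grad \<Omega> u x) \<bullet> (weak_grad \<Omega> z x - weak_grad \<Omega> u x)))"
proof -
  have "1 \<le> p" "0 \<le> p" using exponents by auto
  have deriv: "GDERIV F \<xi> :> F' \<xi>" for \<xi> using F_C1 by blast
  have "isCont F \<xi>" for \<xi> using deriv[of \<xi>] unfolding gderiv_def by (rule has_derivative_continuous)
  then have F_cont: "continuous_on UNIV F" by (simp add: continuous_at_imp_continuous_on)
  have nonneg: "0 \<le> F \<xi>" for \<xi>
  proof -
    have "0 \<le> \<l> * norm \<xi> powr p" using constants by simp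
    then show ?thesis using growth by (meson order_trans)
  qed
  have supp: "F \<eta> + F' \<eta> \<bullet> (\<xi> - \<eta>) \<le> F \<xi>" for \<xi> \<eta>
  proof -
    have "0 \<le> \<nu> * (norm (V p \<xi> - V p \<eta>))\<^sup>2" using constants by simp
    also have "\<dots> \<le> F \<xi> - F \<eta> - F' \<eta> \<bullet> (\<xi> - \<eta>)" using convexity by blast
    finally show ?thesis by simp
  qed
  \<comment> \<open>The ratio 2 fits both the test point 2 \<eta> and the midpoint argument.\<close>
  obtain C where C: "\<And>\<xi>. F (2 *\<^sub>R \<xi>) \<le> C * F \<xi>" using doubling[rule_format, of 2] by auto
  have u: "u \<in> admissible \<Omega> p F \<psi> u\<^sub>0" using minimizer unfolding is_arg_min_def by simp
  interpret finite_measure "lebesgue_on \<Omega>" using \<Omega> by (rule finite_measure_bounded_open)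
  define G where "G = weak_grad \<Omega> u"
  have [measurable]: "F \<in> borel_measurable borel" "F' \<in> borel_measurable borel"
    using F_cont F_C1(2) by (auto intro: borel_measurable_continuous_onI)
  have [measurable]: "G \<in> borel_measurable (lebesgue_on \<Omega>)"
    unfolding G_def by (rule W1p_weak_grad_measurable[OF \<Omega>(1) admissible_W1p[OF \<Omega>(1) \<open>0 \<le> p\<close> boundary u]])
  have int_F: "integrable (lebesgue_on \<Omega>) (\<lambda>x. F (G x))"
    using u unfolding admissible_def G_def by simp
  have int_self: "integrable (lebesgue_on \<Omega>) (\<lambda>x. F' (G x) \<bullet> G x)"
  proof (rule Bochner_Integration.integrable_bound)
    show "integrable (lebesgue_on \<Omega>) (\<lambda>x. C * F (G x) + F 0)" using int_F by simp
    show "AE x in lebesgue_on \<Omega>. norm (F' (G x) \<bullet> G x) \<le> norm (C * F (G x) + F 0)"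
    proof (rule AE_I2)
      show "norm (F' (G x) \<bullet> G x) \<le> norm (C * F (G x) + F 0)" for x
        using subgradient_inner_self_bound[of F F' C "G x", OF supp nonneg C] by simp
    qed
  qed measurable
  \<comment> \<open>Used with h = D\<phi> for the divergence inequality and with h = Dz for the
    variational inequality.\<close>
  have int_inner: "integrable (lebesgue_on \<Omega>) (\<lambda>x. F' (G x) \<bullet> h x)"
    if [measurable]: "h \<in> borel_measurable (lebesgue_on \<Omega>)"
      and int_h: "integrable (lebesgue_on \<Omega>) (\<lambda>x. F (h x))" "integrable (lebesgue_on \<Omega>) (\<lambda>x. F (- h x))" for h
  proof (rule Bochner_Integration.integrable_bound)
    show "integrable (lebesgue_on \<Omega>) (\<lambda>x. F (h x) + F (- h x) + \<bar>F' (G x) \<bullet> G x\<bar>)"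
      using int_h int_self by simp
    show "AE x in lebesgue_on \<Omega>. norm (F' (G x) \<bullet> h x) \<le> norm (F (h x) + F (- h x) + \<bar>F' (G x) \<bullet> G x\<bar>)"
    proof (rule AE_I2)
      show "norm (F' (G x) \<bullet> h x) \<le> norm (F (h x) + F (- h x) + \<bar>F' (G x) \<bullet> G x\<bar>)" for x
        using subgradient_inner_bound[of F F' "G x" "h x", OF supp nonneg] by simp
    qed
  qed measurable
  \<comment> \<open>At F'(Du) the polar equals the real number F'(Du) \<bullet> Du - F(Du), so
    finiteness is immediate and integrability is that of a difference.\<close>
  have "ereal_integrable_on \<Omega> (\<lambda>x. polar F (F' (G x)))"
    unfolding ereal_integrable_on_def polar_at_subgradient[OF supp] using int_F int_self by simp
  moreover have "distributional_div_nonpos \<Omega> (\<lambda>x. F' (G x))"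
    unfolding distributional_div_nonpos_def
  proof (intro ballI impI)
    fix \<phi> assume \<phi>: "\<phi> \<in> test_functions \<Omega>" and \<phi>_nonneg: "\<forall>x. 0 \<le> \<phi> x"
    note cont = test_function_gradient_continuous[OF \<phi>]
    obtain K where K: "compact K" "\<And>x. x \<notin> K \<Longrightarrow> gradient \<phi> x = 0"
      using test_function_support[OF \<phi>] by metis
    obtain B where B: "\<And>x. norm (gradient \<phi> x) \<le> B"
      using continuous_compact_support_bounded[OF cont K] by metis
    have meas[measurable]: "gradient \<phi> \<in> borel_measurable (lebesgue_on \<Omega>)"
      using cont \<Omega> by (intro continuous_imp_measurable_on_sets_lebesgue) (auto intro: continuous_on_subset)
    have int_\<phi>: "integrable (lebesgue_on \<Omega>) (\<lambda>x. F' (G x) \<bullet> gradient \<phi> x)"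
      by (intro int_inner meas bounded_field_integrable[OF \<Omega> F_cont, where B=B])
         (use B in \<open>auto intro!: continuous_intros cont\<close>)
    let ?z = "\<lambda>x. u x + \<phi> x"
    have half: "F ((1/2) *\<^sub>R \<xi> + (1/2) *\<^sub>R \<eta>) \<le> (1/2) * F \<xi> + (1/2) * F \<eta>" for \<xi> \<eta>
      using convex_combination_le[of F F' "1/2" \<xi> \<eta>, OF supp] by simp
    have z: "?z \<in> admissible \<Omega> p F \<psi> u\<^sub>0"
      and grad: "AE x in lebesgue_on \<Omega>. weak_grad \<Omega> ?z x = G x + gradient \<phi> x"
      using admissible_add_test_function[OF \<Omega> \<open>0 \<le> p\<close> boundary F_cont nonneg half C u \<phi>] \<phi>_nonneg
      unfolding G_def by blast+
    have [measurable]: "weak_grad \<Omega> ?z \<in> borel_measurable (lebesgue_on \<Omega>)"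
      by (rule W1p_weak_grad_measurable[OF \<Omega>(1) admissible_W1p[OF \<Omega>(1) \<open>0 \<le> p\<close> boundary z]])
    \<comment> \<open>The increment of the competitor's gradient is D\<phi> almost everywhere, so
      the variational inequality for u + \<phi> is the divergence inequality tested with
      \<phi>.\<close>
    have AE: "AE x in lebesgue_on \<Omega>. F' (G x) \<bullet> gradient \<phi> x = F' (G x) \<bullet> (weak_grad \<Omega> ?z x - G x)"
      using grad by eventually_elim simp
    have "integrable (lebesgue_on \<Omega>) (\<lambda>x. F' (G x) \<bullet> (weak_grad \<Omega> ?z x - G x))"
      by (rule integrable_cong_AE_imp[OF int_\<phi>]) (measurable, use AE in eventually_elim, simp)
    then have "0 \<le> (LINT x|lebesgue_on \<Omega>. F' (G x) \<bullet> (weak_grad \<Omega> ?z x - G x))"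
      using minimizer_variational_inequality[OF \<Omega> \<open>1 \<le> p\<close> boundary deriv nonneg supp minimizer z]
      unfolding G_def by blast
    also have "\<dots> = (LINT x|lebesgue_on \<Omega>. F' (G x) \<bullet> gradient \<phi> x)"
      by (rule integral_cong_AE[OF _ _ AE, symmetric]) measurable
    finally show "integrable (lebesgue_on \<Omega>) (\<lambda>x. F' (G x) \<bullet> gradient \<phi> x) \<and>
        0 \<le> (LINT x|lebesgue_on \<Omega>. F' (G x) \<bullet> gradient \<phi> x)"
      using int_\<phi> by simp
  qed
  moreover have "integrable (lebesgue_on \<Omega>) (\<lambda>x. F' (G x) \<bullet> (weak_grad \<Omega> z x - G x)) \<and>
      0 \<le> (LINT x|lebesgue_on \<Omega>. F' (G x) \<bullet> (weak_grad \<Omega> z x - G x))"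
    if z: "z \<in> admissible \<Omega> p F \<psi> u\<^sub>0"
      and int_z: "integrable (lebesgue_on \<Omega>) (\<lambda>x. F (weak_grad \<Omega> z x))"
        "integrable (lebesgue_on \<Omega>) (\<lambda>x. F (- weak_grad \<Omega> z x))" for z
  proof -
    have "weak_grad \<Omega> z \<in> borel_measurable (lebesgue_on \<Omega>)"
      by (rule W1p_weak_grad_measurable[OF \<Omega>(1) admissible_W1p[OF \<Omega>(1) \<open>0 \<le> p\<close> boundary z]])
    then have int: "integrable (lebesgue_on \<Omega>) (\<lambda>x. F' (G x) \<bullet> (weak_grad \<Omega> z x - G x))"
      unfolding inner_diff_right by (intro Bochner_Integration.integrable_diff int_inner int_z int_self)
    then show ?thesis
      using minimizer_variational_inequality[OF \<Omega> \<open>1 \<le> p\<close> boundary deriv nonneg supp minimizer z]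
      unfolding G_def by blast
  qed
  ultimately show ?thesis using int_self unfolding G_def by blast
qed

end
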